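(* There exists a double series $$\sum_{n,k=1}^\infty c_{n,k}W_n(x)W_k(y)\quad\text{with real coefficients satisfying}\quad \sum_{n,k=1}^\infty |c_{n,k}|^q<\infty\ \text{ for all } q>2,$$ with the following property: for every number $\varepsilon>0$ there exists a measurable function $\mu(x,y)$ on $T=[0,1]^2$ satisfying $$0<\mu(x,y)\le 1,\qquad \left|\{(x,y)\in T:\mu(x,y)\neq 1\}\right|<\varepsilon,$$ such that the series is universal in $L^1_\mu(T)$ concerning rearrangements with respect to convergence in the sense of both spherical and rectangular partial sums.
   Context: $|A|$ denotes the Lebesgue measure of $A$. Walsh–Paley system: let $r_0$ be the $1$-periodic function equal to $1$ on $[0,1/2)$ and $-1$ on $[1/2,1)$, and $r_k(x)=r_0(2^kx)$ for $k\ge 1$. Put $W_0=1$, and for $n=\sum_{s=1}^k 2^{m_s}$ with $m_1>m_2>\dots>m_k\ge 0$ put $W_n(x)=\prod_{s=1}^k r_{m_s}(x)$. For a measurable weight $\mu$ on $T=[0,1]^2$ with $0<\mu\le 1$, $L^1_\mu(T)$ is the space of real measurable functions $f$ on $T$ with $\iint_T|f(x,y)|\mu(x,y)\,dx\,dy<\infty$. For a double series $\sum_{k,\nu=1}^\infty g_{k,\nu}(x,y)$ of functions, the rectangular partial sums are $S_{n,m}=\sum_{k=1}^n\sum_{\nu=1}^m g_{k,\nu}$ and the spherical partial sums are $S_R=\sum_{k^2+\nu^2\le R^2}g_{k,\nu}$. A rearrangement of the double series $\sum_{k,\nu=1}^\infty g_{k,\nu}$ is a double series $\sum_{k,\nu=1}^\infty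 g_{\sigma(k,\nu)}$, where $\sigma$ is a bijection of $\{1,2,\dots\}^2$ onto itself. The double series (here with $g_{k,\nu}(x,y)=c_{k,\nu}W_k(x)W_\nu(y)$) is universal in $L^1_\mu(T)$ concerning rearrangements with respect to convergence in the sense of both spherical and rectangular partial sums if for every $f\in L^1_\mu(T)$ there is a rearrangement whose rectangular partial sums $S_{n,m}$ and spherical partial sums $S_R$ satisfy $\iint_T|S_{n,m}-f|\mu\,dx\,dy\to 0$ as $\min\{n,m\}\to\infty$ and $\iint_T|S_R-f|\mu\,dx\,dy\to 0$ as $R\to\infty$. *)

theory Defs
  imports "HOL-Analysis.Analysis"
begin

definition rademacher :: "nat \<Rightarrow> real \<Rightarrow> real" where
  "rademacher k x = (if frac (2 ^ k * x) < 1 / 2 then 1 else - 1)"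

definition walsh :: "nat \<Rightarrow> real \<Rightarrow> real" where
  "walsh n x = (\<Prod>m | bit n m. rademacher m x)"

lemma bit_sum_powers:
  fixes M :: "nat set"
  assumes "finite M"
  shows "bit (\<Sum>m\<in>M. 2 ^ m :: nat) j \<longleftrightarrow> j \<in> M"
  using assms
proof (induction M arbitrary: j rule: finite_induct)
  case (insert m M)
  let ?s = "\<Sum>m\<in>M. 2 ^ m :: nat"
  have "and (2 ^ m) ?s = 0"
    using insert by (intro bit_eqI) (auto simp: bit_simps)
  then have "2 ^ m + ?s = or (2 ^ m) ?s"
    by (rule disjunctive_add_eq_or)
  then show ?case
    using insert by (auto simp: bit_simps)
qed simp

lemma walsh_0: "walsh 0 x = 1"
  by (simp add: walsh_def)

lemma walsh_sum_powers:
  assumes "finite M"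
  shows "walsh (\<Sum>m\<in>M. 2 ^ m) x = (\<Prod>m\<in>M. rademacher m x)"
  by (simp add: walsh_def bit_sum_powers[OF assms])

abbreviation unit_square :: "(real \<times> real) set" where
  "unit_square \<equiv> {0..1} \<times> {0..1}"

definition weighted_L1_norm ::
    "(real \<times> real \<Rightarrow> real) \<Rightarrow> (real \<times> real \<Rightarrow> real) \<Rightarrow> ennreal" where
  "weighted_L1_norm \<mu> f =
     (\<integral>\<^sup>+ p. ennreal (\<bar>f p\<bar> * \<mu> p) \<partial>lebesgue_on unit_square)"

definition weighted_L1 :: "(real \<times> real \<Rightarrow> real) \<Rightarrow> (real \<times> real \<Rightarrow> real) set" where
  "weighted_L1 \<mu> =
     {f \<in> borel_measurable (lebesgue_on unit_square). weighted_L1_norm \<mu> f < \<infinity>}"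

abbreviation pos_pairs :: "(nat \<times> nat) set" where
  "pos_pairs \<equiv> {1..} \<times> {1..}"

definition rect_sum :: "(nat \<times> nat \<Rightarrow> 'a \<Rightarrow> real) \<Rightarrow> nat \<Rightarrow> nat \<Rightarrow> 'a \<Rightarrow> real" where
  "rect_sum g n m p = (\<Sum>k = 1..n. \<Sum>\<nu> = 1..m. g (k, \<nu>) p)"

definition spher_sum :: "(nat \<times> nat \<Rightarrow> 'a \<Rightarrow> real) \<Rightarrow> real \<Rightarrow> 'a \<Rightarrow> real" where
  "spher_sum g R p =
     (\<Sum>(k, \<nu>) \<in> {(k, \<nu>) \<in> pos_pairs. (real k)\<^sup>2 + (real \<nu>)\<^sup>2 \<le> R\<^sup>2}. g (k, \<nu>) p)"

(* The product filter is the limit along min n m tending to infinity. One and the same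
   rearrangement has to serve both kinds of partial sums. *)
definition universal_rearrangements ::
    "(real \<times> real \<Rightarrow> real) \<Rightarrow> (nat \<times> nat \<Rightarrow> real \<times> real \<Rightarrow> real) \<Rightarrow> bool" where
  "universal_rearrangements \<mu> g \<longleftrightarrow>
     (\<forall>f \<in> weighted_L1 \<mu>. \<exists>\<sigma>. bij_betw \<sigma> pos_pairs pos_pairs \<and>
        ((\<lambda>(n, m). weighted_L1_norm \<mu> (\<lambda>p. rect_sum (g \<circ> \<sigma>) n m p - f p)) \<longlongrightarrow> 0)
          (at_top \<times>\<^sub>F at_top) \<and>
        ((\<lambda>R. weighted_L1_norm \<mu> (\<lambda>p. spher_sum (g \<circ> \<sigma>) R p - f p)) \<longlongrightarrow> 0) at_top)"

end

(* The rearrangement problem is one-dimensional: if all terms with nonzero coefficient are moved to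
   the diagonal positions (j, j), the rectangular and the spherical partial sums both become
   partial sums of one simple series.

   The nonzero coefficients form blocks, one for each s. Block s belongs to a step function phi_s
   that is constant on the dyadic squares ("cells") of level m_s; every rational dyadic step function
   occurs infinitely often. Each cell u gets s binary digits i of its own, and with
   rho_i(x, y) = r_i(x) r_i(y) the function 1_u (1 - prod_i (1 + rho_i)) is a sum of Walsh
   characters with coefficients of modulus 4^(-m_s). It equals 1_u except on a part of u of relative
   measure 2^(-s), where it is 1 - 2^s. Adding up its multiples over all cells gives a
   polynomial that equals phi_s outside a set of measure 2^(-s). Its partial sums, taken cell by
   cell, are dominated by |phi_s| there, up to the incomplete cell, which is small in L^2 when m_s
   is large; large m_s also makes the sum of |c|^q converge for each q > 2. The weight is chosen tiny
   on the exceptional sets from some s on.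

   For f in the weighted space one then alternately appends the next unused term h and a whole
   block whose phi_s approximates f - (sum so far) - h. *)

theory Submission
  imports Defs "HOL-Library.Function_Algebras"
begin

section \<open>Walsh functions and dyadic cells\<close>

text \<open>The indicator of a cell uses only characters of index below 2^m, which all cells and all
  blocks would have to share, although each character has just one coefficient. The factor 1 - prod
  (1 + rho_i) moves the spectrum to frequencies that carry digits private to the cell, so all terms
  are different characters. This forces the product to have mean 1, hence to be large on a small
  set, and that set is what the weight has to hide. Pairing r_i(x) with r_i(y) puts the same digit
  into both coordinates. If 2^b bounds |phi_s|, block s has at most 4^m * 4^m * 2^s coefficients, of
  modulus at most 2^b 4^(-m). The sum of their q-th powers is of order 4^((2-q)m) apart from factors
  free of m, so q > 2 is the range in which a large m helps. The series does not depend on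
  \<epsilon>. Only the index from which the weight is lowered does, and since every step function
  recurs infinitely often, skipping finitely many blocks as approximants is harmless; their terms
  are placed one at a time.\<close>

lemma rademacher_cases: "rademacher k x = 1 \<or> rademacher k x = -1"
  by (simp add: rademacher_def)

lemma rademacher_square [simp]: "rademacher k x * rademacher k x = 1"
  by (simp add: rademacher_def)

lemma abs_rademacher [simp]: "\<bar>rademacher k x\<bar> = 1"
  by (simp add: rademacher_def)

lemma finite_bits: "finite {m. bit (n::nat) m}"
proof (rule finite_subset)
  show "{m. bit n m} \<subseteq> {..n}"
  proof
    fix m assume "m \<in> {m. bit n m}"
    then have "2 ^ m \<le> n"
      by (metis bit_nat_def div_less even_zero mem_Collect_eq not_le)
    then show "m \<in> {..n}"
      using less_exp[of m] by (metis atMost_iff le_trans less_imp_le)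
  qed
qed simp

lemma abs_walsh [simp]: "\<bar>walsh n x\<bar> = 1"
  by (simp add: walsh_def abs_prod)

lemma walsh_square [simp]: "walsh n x * walsh n x = 1"
  by (simp add: walsh_def flip: prod.distrib)

text \<open>Digits common to both indices contribute squares of Rademacher functions, which are 1,
  so only the symmetric difference survives. Multiplying characters thus becomes xor of indices, the
  rule behind all later computations with frequencies.\<close>

lemma walsh_xor: "walsh n x * walsh k x = walsh (xor n k) x"
proof -
  let ?N = "{m. bit n m}" and ?K = "{m. bit k m}"
  let ?R = "prod (\<lambda>m. rademacher m x)"
  have fin: "finite ?N" "finite ?K" by (rule finite_bits)+
  have 1: "?R ?N = ?R (?N - ?K) * ?R (?N \<inter> ?K)"
    using fin by (subst prod.union_disjoint[symmetric]) (auto intro: prod.cong)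
  have 2: "?R ?K = ?R (?K - ?N) * ?R (?N \<inter> ?K)"
    using fin by (subst prod.union_disjoint[symmetric]) (auto intro: prod.cong)
  have 3: "?R {m. bit (xor n k) m} = ?R (?N - ?K) * ?R (?K - ?N)"
    using fin by (subst prod.union_disjoint[symmetric]) (auto intro!: prod.cong simp: bit_xor_iff)
  have 4: "?R (?N \<inter> ?K) * ?R (?N \<inter> ?K) = 1"
    by (simp flip: prod.distrib)
  show ?thesis
    unfolding walsh_def 1 2 3 using 4 by algebra
qed

text \<open>Doubling the index shifts all binary digits up by one, and
  \<open>rademacher (Suc m) x\<close> is \<open>rademacher m (2 * x)\<close>. Together with the odd
  case below, this gives the halving of the index on which \<open>integral_walsh_aux\<close>
  rests.\<close>

lemma walsh_bit0: "walsh (2 * n) x = walsh n (2 * x)"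
proof -
  have "{m. bit (2 * n) m} = Suc ` {m. bit n m}"
    by (auto simp: bit_double_iff image_iff gr0_conv_Suc)
  then show ?thesis
    by (simp add: walsh_def prod.reindex rademacher_def mult.assoc mult.left_commute)
qed

lemma walsh_bit1: "walsh (2 * n + 1) x = rademacher 0 x * walsh n (2 * x)"
proof -
  have "2 * n + 1 = xor 1 (2 * n)"
  proof -
    have "and (2 * n) 1 = 0"
      using and_one_eq[of "2 * n"] by simp
    then show ?thesis
      by (metis disjunctive_add_eq_or disjunctive_xor_eq_or xor.commute)
  qed
  moreover have "walsh 1 x = rademacher 0 x"
    using walsh_sum_powers[of "{0}" x] by simp
  ultimately show ?thesis
    by (metis walsh_bit0 walsh_xor)
qed

lemma rademacher_periodic: "rademacher k (x + 1) = rademacher k x"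
proof -
  have "frac (2 ^ k * (x + 1)) = frac (2 ^ k * x + of_int (2 ^ k))"
    by (simp add: algebra_simps)
  also have "\<dots> = frac (2 ^ k * x)"
    by (rule frac_add_of_int_right)
  finally show ?thesis by (simp add: rademacher_def)
qed

lemma walsh_periodic: "walsh n (x + 1) = walsh n x"
  by (simp add: walsh_def rademacher_periodic)

section \<open>Integrals of Walsh functions\<close>

lemma measurable_rademacher [measurable]: "rademacher k \<in> borel_measurable borel"
  unfolding rademacher_def[abs_def] frac_def by measurable

lemma measurable_walsh [measurable]: "walsh n \<in> borel_measurable borel"
  unfolding walsh_def[abs_def] by (intro borel_measurable_prod) measurable

text \<open>On each half of the interval the function is a compressed copy of
  \<open>walsh (n div 2)\<close>. For odd n the factor \<open>rademacher 0\<close> gives the two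
  copies opposite signs and they cancel; for even n the halved index is still positive and the
  induction hypothesis applies.\<close>

lemma integral_walsh_aux:
  assumes "n > 0"
  shows "(LINT x|lborel. indicator {0..<1} x * walsh n x) = 0"
  using assms
proof (induction n rule: less_induct)
  case (less n)
  define I where "I k = (LINT x|lborel. indicator {0..<1::real} x * walsh k x)" for k
  have half: "(LINT x|lborel. indicator {t/2..<t/2+1/2} x * walsh k (2 * x)) = I k / 2"
    if "t = 0 \<or> t = 1" for t :: real and k
  proof -
    have "I k = 2 * (LINT x|lborel. indicator {0..<1} (-t + 2 * x) * walsh k (-t + 2 * x))"
      unfolding I_def
      using lborel_integral_real_affine[of 2 "\<lambda>x. indicator {0..<1} x * walsh k x" "-t"]
      by simp
    \<comment> \<open>The period 1 absorbs the shift by t = 1, so both halves give the same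
      integral.\<close>
    moreover have "walsh k (-t + 2 * x) = walsh k (2 * x)" for x
      using that walsh_periodic[of k "-1 + 2 * x"] by (auto simp: algebra_simps)
    moreover have "indicator {0..<1} (-t + 2 * x) = (indicator {t/2..<t/2+1/2} x :: real)" for x
      by (auto simp: indicator_def)
    ultimately show ?thesis by simp
  qed
  have int: "integrable lborel (\<lambda>x. indicator {t/2..<t/2+1/2::real} x * walsh k (2 * x))" for t k
  proof -
    have "integrable lborel (indicator {t/2..<t/2+1/2::real} :: real \<Rightarrow> real)"
      by (intro integrable_real_indicator emeasure_bounded_finite) auto
    then show ?thesis
      by (rule Bochner_Integration.integrable_bound) (auto simp: abs_mult)
  qed
  define k where "k = n div 2"
  have "n = 2 * k \<or> n = 2 * k + 1"
    unfolding k_def by presburger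
  then consider "n = 2 * k" | "n = 2 * k + 1" by blast
  then show ?case
  proof cases
    case 1
    have "indicator {0..<1} x * walsh n x = indicator {0/2..<0/2+1/2} x * walsh k (2 * x)
        + indicator {1/2..<1/2+1/2} x * walsh k (2 * x)" for x
      by (auto simp: 1 walsh_bit0 indicator_def)
    then have "(LINT x|lborel. indicator {0..<1} x * walsh n x) = I k / 2 + I k / 2"
      using half[of 0 k] half[of 1 k] int[of 0 k] int[of 1 k]
      by (simp add: Bochner_Integration.integral_add del: div_0 add_0)
    moreover have "I k = 0"
      using less 1 by (simp add: I_def)
    ultimately show ?thesis by simp
  next
    case 2
    have "rademacher 0 x = 1" if "0 \<le> x" "x < 1 / 2" for x
      using that by (simp add: rademacher_def)
    moreover have "rademacher 0 x = -1" if "1 / 2 \<le> x" "x < 1" for x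
      using that by (simp add: rademacher_def)
    ultimately have "indicator {0..<1} x * walsh n x = indicator {0/2..<0/2+1/2} x * walsh k (2 * x)
        - indicator {1/2..<1/2+1/2} x * walsh k (2 * x)" for x
      unfolding 2 walsh_bit1 by (auto simp: indicator_def)
    then have "(LINT x|lborel. indicator {0..<1} x * walsh n x) = I k / 2 - I k / 2"
      using half[of 0 k] half[of 1 k] int[of 0 k] int[of 1 k]
      by (simp add: Bochner_Integration.integral_diff del: div_0 add_0)
    then show ?thesis by simp
  qed
qed

lemma integral_walsh:
  "(LINT x|lborel. indicator {0..1} x * walsh n x) = (if n = 0 then 1 else 0)"
proof -
  have "AE x in lborel. indicator {0..1} x * walsh n x = indicator {0..<1} x * walsh n x"
    using AE_lborel_singleton[of 1] by eventually_elim (auto simp: indicator_def)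
  then have "(LINT x|lborel. indicator {0..1} x * walsh n x)
      = (LINT x|lborel. indicator {0..<1} x * walsh n x)"
    by (intro integral_cong_AE) auto
  then show ?thesis
    using integral_walsh_aux[of n] by (auto simp: walsh_0)
qed

section \<open>The Walsh system on the unit square\<close>

definition walsh2 :: "nat \<times> nat \<Rightarrow> real \<times> real \<Rightarrow> real" where
  "walsh2 p z = walsh (fst p) (fst z) * walsh (snd p) (snd z)"

abbreviation square_measure :: "(real \<times> real) measure" where
  "square_measure \<equiv> lebesgue_on unit_square"

lemma abs_walsh2 [simp]: "\<bar>walsh2 p z\<bar> = 1"
  by (simp add: walsh2_def abs_mult)

lemma walsh2_mult: "walsh2 p z * walsh2 q z = walsh2 (xor (fst p) (fst q), xor (snd p) (snd q)) z"
  by (simp add: walsh2_def flip: walsh_xor)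

lemma borel_measurable_walsh2 [measurable]: "walsh2 p \<in> borel_measurable borel"
  unfolding walsh2_def[abs_def]
  by (intro borel_measurable_times measurable_compose[OF _ measurable_walsh]
      borel_measurable_continuous_onI continuous_intros)

lemma borel_imp_square_measurable:
  "f \<in> borel_measurable borel \<Longrightarrow> f \<in> borel_measurable square_measure"
  by (intro measurable_restrict_space1 measurable_completion) simp

lemma measurable_walsh2 [measurable]: "walsh2 p \<in> borel_measurable square_measure"
  by (intro borel_imp_square_measurable borel_measurable_walsh2)

lemma unit_square_sets [measurable]: "unit_square \<in> sets lebesgue"
  by (metis box_real(2) borel_closed closed_Times closed_atLeastAtMost sets_completionI_sets sets_lborel)

lemma emeasure_unit_square: "emeasure lebesgue unit_square = 1"
proof -
  have "emeasure lebesgue unit_square = emeasure (lborel \<Otimes>\<^sub>M lborel) unit_square"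
    by (simp add: lborel_prod emeasure_completion borel_closed closed_Times)
  also have "\<dots> = 1"
    by (subst lborel.emeasure_pair_measure_Times) auto
  finally show ?thesis .
qed

interpretation sq: finite_measure square_measure
  by standard (simp add: emeasure_restrict_space emeasure_unit_square)

lemma measure_square [simp]: "measure square_measure unit_square = 1"
  by (simp add: measure_def emeasure_restrict_space emeasure_unit_square)

lemma integrable_walsh2 [simp]: "integrable square_measure (walsh2 p)"
  by (rule sq.integrable_const_bound[of _ 1]) auto

text \<open>Fubini applies to the Borel product measure, so the completed measure is exchanged for
  it; the integral of a character then is a product of two one-dimensional ones.\<close>

lemma integral_walsh2: "integral\<^sup>L square_measure (walsh2 p) = (if p = (0, 0) then 1 else 0)"
proof -
  define g where "g n x = indicator {0..1::real} x * walsh n x" for n x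
  have [measurable]: "g n \<in> borel_measurable borel" for n
    unfolding g_def[abs_def] by measurable
  have "integral\<^sup>L square_measure (walsh2 p) = (LINT z|lebesgue. indicator unit_square z * walsh2 p z)"
    by (subst integral_restrict_space) auto
  also have "\<dots> = (LINT z|lborel. indicator unit_square z * walsh2 p z)"
    by (intro integral_completion) (simp add: borel_closed closed_Times)
  also have "\<dots> = (LINT z|(lborel \<Otimes>\<^sub>M lborel). g (fst p) (fst z) * g (snd p) (snd z))"
    by (simp add: lborel_prod g_def walsh2_def indicator_times mult_ac)
  also have "\<dots> = (LINT x|lborel. LINT y|lborel. g (fst p) x * g (snd p) y)"
  proof -
    have "integrable (lborel \<Otimes>\<^sub>M lborel) (indicator unit_square :: _ \<Rightarrow> real)"
      using emeasure_unit_square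
      by (intro integrable_real_indicator) (auto simp: lborel_prod borel_closed closed_Times)
    then have "integrable (lborel \<Otimes>\<^sub>M lborel) (\<lambda>z. g (fst p) (fst z) * g (snd p) (snd z))"
      by (rule Bochner_Integration.integrable_bound)
        (auto simp: g_def abs_mult indicator_def intro!: borel_measurable_times)
    from lborel_pair.integral_fst'[OF this] show ?thesis by simp
  qed
  also have "\<dots> = (LINT x|lborel. g (fst p) x) * (LINT y|lborel. g (snd p) y)"
    by simp
  finally show ?thesis
    unfolding g_def integral_walsh by (cases p) auto
qed

lemma integral_walsh2_mult:
  "(LINT z|square_measure. walsh2 p z * walsh2 q z) = (if p = q then 1 else 0)"
proof -
  have "xor a b = 0 \<longleftrightarrow> a = b" for a b :: nat
    by (auto simp: bit_eq_iff bit_xor_iff)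
  then show ?thesis
    unfolding walsh2_mult integral_walsh2 by (auto simp: prod_eq_iff)
qed

text \<open>Orthonormality turns the sum of squared coefficients into the integral of the square. To
  reach the integral of the absolute value, the pointwise bound \<open>amgm\<close>, tuned to the
  target t, replaces Cauchy-Schwarz; each of its two terms contributes at most t / 2.\<close>

lemma integral_abs_walsh2_sum_le:
  assumes "finite F" "0 < t" "(\<Sum>p\<in>F. (a p)\<^sup>2) \<le> t\<^sup>2"
  shows "(LINT z|square_measure. \<bar>\<Sum>p\<in>F. a p * walsh2 p z\<bar>) \<le> t"
proof -
  let ?f = "\<lambda>z. \<Sum>p\<in>F. a p * walsh2 p z"
  have sq: "(?f z)\<^sup>2 = (\<Sum>p\<in>F. \<Sum>q\<in>F. a p * a q * (walsh2 p z * walsh2 q z))" for z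
    by (simp add: power2_eq_square sum_product mult_ac)
  have int: "integrable square_measure (\<lambda>z. walsh2 p z * walsh2 q z)" for p q
    by (simp add: walsh2_mult)
  have "(LINT z|square_measure. (?f z)\<^sup>2) = (\<Sum>p\<in>F. \<Sum>q\<in>F. a p * a q * (if p = q then 1 else 0))"
    unfolding sq integral_walsh2_mult[symmetric] using int
    by (simp add: Bochner_Integration.integral_sum integrable_sum)
  also have "\<dots> = (\<Sum>p\<in>F. (a p)\<^sup>2)"
    using assms(1) by (simp add: power2_eq_square if_distrib cong: if_cong)
  finally have le: "(LINT z|square_measure. (?f z)\<^sup>2) \<le> t\<^sup>2" using assms by simp
  have intsq: "integrable square_measure (\<lambda>z. (?f z)\<^sup>2)"
    unfolding sq using int by auto
  have amgm: "\<bar>?f z\<bar> \<le> t / 2 + (?f z)\<^sup>2 / (2 * t)" for z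
  proof -
    have "0 \<le> (\<bar>?f z\<bar> - t)\<^sup>2" by simp
    then have "2 * t * \<bar>?f z\<bar> \<le> t\<^sup>2 + (?f z)\<^sup>2" by (simp add: power2_diff algebra_simps)
    with \<open>0 < t\<close> show ?thesis by (simp add: field_simps power2_eq_square)
  qed
  have "(LINT z|square_measure. \<bar>?f z\<bar>) \<le> (LINT z|square_measure. t / 2 + (?f z)\<^sup>2 / (2 * t))"
    using amgm intsq by (intro integral_mono) auto
  also have "\<dots> = t / 2 + (LINT z|square_measure. (?f z)\<^sup>2) / (2 * t)"
    using intsq by simp
  also have "\<dots> \<le> t / 2 + t\<^sup>2 / (2 * t)"
    using le \<open>0 < t\<close> by (intro add_left_mono divide_right_mono) auto
  also have "\<dots> = t" using \<open>0 < t\<close> by (simp add: power2_eq_square field_simps)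
  finally show ?thesis .
qed

text \<open>The number of the dyadic interval of length 2^(-m) that contains x. Reduction mod 2^m
  makes it periodic like the Rademacher functions; in particular the point 1 falls into interval 0,
  which is why statements about distances exclude it.\<close>

definition dyadic_index :: "nat \<Rightarrow> real \<Rightarrow> nat" where
  "dyadic_index m x = nat (\<lfloor>2 ^ m * x\<rfloor> mod 2 ^ m)"

lemma dyadic_index_less: "dyadic_index m x < 2 ^ m"
  by (simp add: dyadic_index_def nat_less_iff)

text \<open>The sign of \<open>rademacher m\<close> tells in which half of its level m interval x
  lies, that is, the next binary digit of x.\<close>

lemma dyadic_index_Suc:
  "dyadic_index (Suc m) x = 2 * dyadic_index m x + (if rademacher m x = 1 then 0 else 1)"
proof -
  define y where "y = 2 ^ m * x"
  define e :: int where "e = (if frac y < 1 / 2 then 0 else 1)"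
  have "\<lfloor>2 * y\<rfloor> = 2 * \<lfloor>y\<rfloor> + e"
    by (rule floor_unique) (auto simp: e_def frac_def; linarith)+
  moreover have "(2 * \<lfloor>y\<rfloor> + e) mod (2 * 2 ^ m) = 2 * (\<lfloor>y\<rfloor> mod 2 ^ m) + e"
  proof -
    have "0 \<le> e" "e < 2" by (auto simp: e_def)
    moreover have "0 \<le> \<lfloor>y\<rfloor> mod 2 ^ m" "\<lfloor>y\<rfloor> mod 2 ^ m < 2 ^ m" by auto
    ultimately have "0 \<le> 2 * (\<lfloor>y\<rfloor> mod 2 ^ m) + e" "2 * (\<lfloor>y\<rfloor> mod 2 ^ m) + e < 2 * 2 ^ m"
      by linarith+
    then have "(2 * (\<lfloor>y\<rfloor> mod 2 ^ m) + e) mod (2 * 2 ^ m) = 2 * (\<lfloor>y\<rfloor> mod 2 ^ m) + e"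
      by (rule mod_pos_pos_trivial)
    moreover have "2 * (\<lfloor>y\<rfloor> mod 2 ^ m) = (2 * \<lfloor>y\<rfloor>) mod (2 * 2 ^ m)"
      by (rule mult_mod_right)
    ultimately show ?thesis by (metis mod_add_left_eq)
  qed
  ultimately have "nat (\<lfloor>2 * y\<rfloor> mod (2 * 2 ^ m)) = 2 * nat (\<lfloor>y\<rfloor> mod 2 ^ m) + nat e"
    by (auto simp: nat_add_distrib nat_mult_distrib e_def)
  then show ?thesis
    by (simp add: dyadic_index_def y_def e_def rademacher_def mult.assoc)
qed

text \<open>A factor is 2 where the binary digits of x and y agree and 0 where they differ, so the
  product survives only if all of the first m digits agree.\<close>

lemma prod_rademacher_eq:
  "(\<Prod>i<m. 1 + rademacher i x * rademacher i y)
    = (if dyadic_index m x = dyadic_index m y then 2 ^ m else 0)"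
proof (induction m)
  case 0
  show ?case by (simp add: dyadic_index_def)
next
  case (Suc m)
  have "2 * a + (if u then 0 else 1) = 2 * b + (if v then 0 else 1) \<longleftrightarrow> a = b \<and> u = v"
    for a b :: nat and u v
    by (auto; presburger)
  then show ?case
    using Suc rademacher_cases[of m x] rademacher_cases[of m y]
    by (auto simp: dyadic_index_Suc)
qed

section \<open>Cell indicators as Walsh polynomials\<close>

lemma walsh_add_power:
  assumes "n < 2 ^ m"
  shows "walsh (n + 2 ^ m) x = walsh n x * rademacher m x"
proof -
  have "xor n (2 ^ m) = n + 2 ^ m"
  proof -
    have "\<not> bit n m"
      using assms by (simp add: bit_nat_def)
    then have "and n (2 ^ m) = 0"
      by (intro bit_eqI) (auto simp: bit_simps)
    then show ?thesis
      by (metis disjunctive_add_eq_or disjunctive_xor_eq_or)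
  qed
  then show ?thesis
    using walsh_sum_powers[of "{m}" x] walsh_xor[of n x "2 ^ m"] by simp
qed

text \<open>The left side is the Dirichlet kernel of order 2^m. The indices from 2^m on repeat the
  lower ones with the extra digit m, which produces the next factor of the product.\<close>

lemma sum_walsh_eq_prod:
  "(\<Sum>n<2 ^ m. walsh n x * walsh n y) = (\<Prod>i<m. 1 + rademacher i x * rademacher i y)"
proof (induction m)
  case (Suc m)
  have "(\<Sum>n<2 ^ Suc m. walsh n x * walsh n y)
      = (\<Sum>n<2 ^ m. walsh n x * walsh n y) + (\<Sum>n = 2 ^ m..<2 ^ m + 2 ^ m. walsh n x * walsh n y)"
    by (simp add: lessThan_atLeast0 sum.atLeastLessThan_concat mult_2)
  also have "(\<Sum>n = 2 ^ m..<2 ^ m + 2 ^ m. walsh n x * walsh n y)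
      = (\<Sum>n<2 ^ m. walsh (n + 2 ^ m) x * walsh (n + 2 ^ m) y)"
    using sum.shift_bounds_nat_ivl[of "\<lambda>n. walsh n x * walsh n y" 0 "2 ^ m" "2 ^ m"]
    by (simp add: lessThan_atLeast0)
  also have "\<dots> = (\<Sum>n<2 ^ m. walsh n x * walsh n y) * (rademacher m x * rademacher m y)"
    by (simp add: walsh_add_power sum_distrib_left sum_distrib_right mult_ac)
  finally show ?case
    using Suc by (simp add: algebra_simps)
qed (simp add: walsh_0)

lemma dyadic_index_corner:
  assumes "a < 2 ^ m"
  shows "dyadic_index m (real a / 2 ^ m) = a"
  using assms by (simp add: dyadic_index_def nat_mod_as_int flip: of_nat_mod)

text \<open>With one argument fixed at the left endpoint a / 2^m, the Dirichlet kernel is 2^m on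
  that interval and 0 elsewhere. Dividing by 2^m gives the Walsh expansion of the indicator, all of
  whose coefficients have modulus 2^(-m).\<close>

lemma dyadic_indicator_eq:
  assumes "a < 2 ^ m"
  shows "of_bool (dyadic_index m x = a) = (\<Sum>n<2 ^ m. walsh n (real a / 2 ^ m) / 2 ^ m * walsh n x)"
proof -
  have "(\<Sum>n<2 ^ m. walsh n (real a / 2 ^ m) / 2 ^ m * walsh n x)
      = (\<Sum>n<2 ^ m. walsh n (real a / 2 ^ m) * walsh n x) / 2 ^ m"
    by (simp add: sum_divide_distrib)
  then show ?thesis
    using assms by (simp add: sum_walsh_eq_prod prod_rademacher_eq dyadic_index_corner)
qed

section \<open>The weighted space and density of dyadic step functions\<close>

text \<open>A real-valued form of \<open>weighted_L1_norm\<close>, convenient for subtractions and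
  limits; \<open>weighted_L1_norm_eq\<close> translates back. The Bochner integral of a
  non-integrable function is 0, so the triangle inequalities below come with membership in
  \<open>weighted_L1\<close>.\<close>

definition weighted_integral :: "(real \<times> real \<Rightarrow> real) \<Rightarrow> (real \<times> real \<Rightarrow> real) \<Rightarrow> real" where
  "weighted_integral \<mu> f = (LINT z|square_measure. \<bar>f z\<bar> * \<mu> z)"

definition weight :: "(real \<times> real \<Rightarrow> real) \<Rightarrow> bool" where
  "weight \<mu> \<longleftrightarrow> \<mu> \<in> borel_measurable square_measure \<and> (\<forall>z\<in>unit_square. 0 < \<mu> z \<and> \<mu> z \<le> 1)"

lemma weightD:
  assumes "weight \<mu>"
  shows "\<mu> \<in> borel_measurable square_measure" "\<And>z. z \<in> unit_square \<Longrightarrow> 0 \<le> \<mu> z"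
    "\<And>z. z \<in> unit_square \<Longrightarrow> \<mu> z \<le> 1"
  using assms by (auto simp: weight_def less_imp_le)

lemma weighted_L1_iff:
  assumes "weight \<mu>"
  shows "f \<in> weighted_L1 \<mu> \<longleftrightarrow>
    f \<in> borel_measurable square_measure \<and> integrable square_measure (\<lambda>z. \<bar>f z\<bar> * \<mu> z)"
proof -
  note [measurable] = weightD(1)[OF assms]
  have "(\<integral>\<^sup>+ z. ennreal (norm (\<bar>f z\<bar> * \<mu> z)) \<partial>square_measure) = weighted_L1_norm \<mu> f"
    unfolding weighted_L1_norm_def
    by (intro nn_integral_cong) (auto simp: abs_mult weightD(2)[OF assms])
  then show ?thesis
    unfolding weighted_L1_def integrable_iff_bounded by auto
qed

lemma weighted_L1_norm_eq:
  assumes "weight \<mu>" "f \<in> weighted_L1 \<mu>"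
  shows "weighted_L1_norm \<mu> f = ennreal (weighted_integral \<mu> f)"
  unfolding weighted_L1_norm_def weighted_integral_def
  using assms weightD(2)[OF assms(1)]
  by (intro nn_integral_eq_integral AE_I2) (auto simp: weighted_L1_iff)

lemma weighted_L1_bounded:
  assumes "weight \<mu>" "f \<in> borel_measurable square_measure" "\<And>z. z \<in> unit_square \<Longrightarrow> \<bar>f z\<bar> \<le> B"
  shows "f \<in> weighted_L1 \<mu>"
proof -
  note [measurable] = weightD(1)[OF assms(1)] assms(2)
  have "integrable square_measure (\<lambda>z. \<bar>f z\<bar> * \<mu> z)"
  proof (rule sq.integrable_const_bound[of _ B])
    show "AE z in square_measure. norm (\<bar>f z\<bar> * \<mu> z) \<le> B"
    proof (rule AE_I2)
      fix z assume "z \<in> space square_measure"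
      then have z: "z \<in> unit_square" by simp
      have "\<bar>f z\<bar> * \<mu> z \<le> B * 1"
        using assms(3)[OF z] weightD(2,3)[OF assms(1) z] by (intro mult_mono) auto
      then show "norm (\<bar>f z\<bar> * \<mu> z) \<le> B"
        using weightD(2)[OF assms(1) z] by (simp add: abs_mult)
    qed
  qed measurable
  then show ?thesis using assms by (simp add: weighted_L1_iff)
qed

lemma weighted_L1_add:
  assumes "weight \<mu>" "f \<in> weighted_L1 \<mu>" "g \<in> weighted_L1 \<mu>"
  shows "(\<lambda>z. f z + g z) \<in> weighted_L1 \<mu>"
    and "weighted_integral \<mu> (\<lambda>z. f z + g z) \<le> weighted_integral \<mu> f + weighted_integral \<mu> g"
proof -
  note [measurable] = weightD(1)[OF assms(1)]
  have [measurable]: "f \<in> borel_measurable square_measure" "g \<in> borel_measurable square_measure"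
    and int: "integrable square_measure (\<lambda>z. \<bar>f z\<bar> * \<mu> z)" "integrable square_measure (\<lambda>z. \<bar>g z\<bar> * \<mu> z)"
    using assms by (simp_all add: weighted_L1_iff)
  have le: "\<bar>f z + g z\<bar> * \<mu> z \<le> \<bar>f z\<bar> * \<mu> z + \<bar>g z\<bar> * \<mu> z" if "z \<in> unit_square" for z
    using weightD(2)[OF assms(1) that] abs_triangle_ineq[of "f z" "g z"]
    by (simp add: mult_right_mono flip: distrib_right)
  have int': "integrable square_measure (\<lambda>z. \<bar>f z + g z\<bar> * \<mu> z)"
  proof (rule Bochner_Integration.integrable_bound[OF Bochner_Integration.integrable_add[OF int]])
    show "AE z in square_measure. norm (\<bar>f z + g z\<bar> * \<mu> z) \<le> norm (\<bar>f z\<bar> * \<mu> z + \<bar>g z\<bar> * \<mu> z)"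
    proof (rule AE_I2)
      fix z assume "z \<in> space square_measure"
      then have z: "z \<in> unit_square" by simp
      show "norm (\<bar>f z + g z\<bar> * \<mu> z) \<le> norm (\<bar>f z\<bar> * \<mu> z + \<bar>g z\<bar> * \<mu> z)"
        using le[OF z] weightD(2)[OF assms(1) z] by (simp add: abs_mult)
    qed
  qed measurable
  then show "(\<lambda>z. f z + g z) \<in> weighted_L1 \<mu>"
    using assms(1) by (simp add: weighted_L1_iff)
  have "weighted_integral \<mu> (\<lambda>z. f z + g z) \<le> (LINT z|square_measure. \<bar>f z\<bar> * \<mu> z + \<bar>g z\<bar> * \<mu> z)"
    unfolding weighted_integral_def
    using int int' le by (intro integral_mono) auto
  then show "weighted_integral \<mu> (\<lambda>z. f z + g z) \<le> weighted_integral \<mu> f + weighted_integral \<mu> g"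
    using int by (simp add: weighted_integral_def)
qed

lemma weighted_L1_minus:
  assumes "weight \<mu>" "f \<in> weighted_L1 \<mu>"
  shows "(\<lambda>z. - f z) \<in> weighted_L1 \<mu>" "weighted_integral \<mu> (\<lambda>z. - f z) = weighted_integral \<mu> f"
  using assms by (auto simp: weighted_L1_iff weighted_integral_def)

lemma weighted_L1_diff:
  assumes "weight \<mu>" "f \<in> weighted_L1 \<mu>" "g \<in> weighted_L1 \<mu>"
  shows "(\<lambda>z. f z - g z) \<in> weighted_L1 \<mu>"
    and "weighted_integral \<mu> (\<lambda>z. f z - g z) \<le> weighted_integral \<mu> f + weighted_integral \<mu> g"
  using weighted_L1_add[OF assms(1,2) weighted_L1_minus(1)[OF assms(1,3)]]
    weighted_L1_minus(2)[OF assms(1,3)] by simp_all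

lemma weighted_integral_nonneg:
  assumes "weight \<mu>"
  shows "0 \<le> weighted_integral \<mu> f"
  unfolding weighted_integral_def
  using weightD(2)[OF assms] by (intro integral_nonneg_AE AE_I2) auto

text \<open>Splits a function of the cell into finitely many terms with cell indicators as factors.
  Its measurability thus reduces to that of the indicators, which are Walsh polynomials.\<close>

lemma sum_dyadic_cells:
  "G (dyadic_index m x) (dyadic_index m y)
    = (\<Sum>a<2 ^ m. \<Sum>b<2 ^ m. of_bool (dyadic_index m x = a) * of_bool (dyadic_index m y = b) * (G a b :: real))"
proof -
  have "(\<Sum>a<2 ^ m. \<Sum>b<2 ^ m. of_bool (dyadic_index m x = a) * of_bool (dyadic_index m y = b) * G a b)
      = (\<Sum>a<2 ^ m. if a = dyadic_index m x then
          \<Sum>b<2 ^ m. if b = dyadic_index m y then G a b else 0 else 0)"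
    by (intro sum.cong refl) (auto intro!: sum.cong)
  then show ?thesis by (simp add: dyadic_index_less)
qed

lemma borel_measurable_dyadic_cell:
  "a < 2 ^ m \<Longrightarrow> (\<lambda>x. of_bool (dyadic_index m x = a) :: real) \<in> borel_measurable borel"
  unfolding dyadic_indicator_eq by measurable

lemma measurable_dyadic_cells:
  assumes "\<And>a b. a < 2 ^ m \<Longrightarrow> b < 2 ^ m \<Longrightarrow> G a b \<in> borel_measurable borel"
  shows "(\<lambda>z. G (dyadic_index m (fst z)) (dyadic_index m (snd z)) z :: real) \<in> borel_measurable borel"
proof -
  have "(\<lambda>z. of_bool (dyadic_index m (fst z) = a) :: real) \<in> borel_measurable borel"
    "(\<lambda>z. of_bool (dyadic_index m (snd z) = a) :: real) \<in> borel_measurable borel" if "a < 2 ^ m" for a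
    by (intro measurable_compose[OF _ borel_measurable_dyadic_cell[OF that]]
        borel_measurable_continuous_onI continuous_intros)+
  then have "(\<lambda>z. \<Sum>a<2 ^ m. \<Sum>b<2 ^ m. of_bool (dyadic_index m (fst z) = a) *
      of_bool (dyadic_index m (snd z) = b) * G a b z) \<in> borel_measurable borel"
    using assms by (intro borel_measurable_sum borel_measurable_times) auto
  moreover have "(\<lambda>z. G (dyadic_index m (fst z)) (dyadic_index m (snd z)) z) =
     (\<lambda>z. \<Sum>a<2 ^ m. \<Sum>b<2 ^ m. of_bool (dyadic_index m (fst z) = a) *
      of_bool (dyadic_index m (snd z) = b) * G a b z)"
    by (intro ext) (rule sum_dyadic_cells[where G = "\<lambda>a b. G a b _"])
  ultimately show ?thesis by simp
qed

text \<open>Dyadic step functions of level \<open>d\<close> with rational values, given by the row-major list of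
  their values.\<close>

definition dyadic_step :: "nat \<Rightarrow> rat list \<Rightarrow> real \<times> real \<Rightarrow> real" where
  "dyadic_step d vs z = (let i = dyadic_index d (fst z) * 2 ^ d + dyadic_index d (snd z)
     in if i < length vs then of_rat (vs ! i) else 0)"

lemma borel_measurable_dyadic_step: "dyadic_step d vs \<in> borel_measurable borel"
  unfolding dyadic_step_def[abs_def]
  by (rule measurable_dyadic_cells[where G = "\<lambda>a b z. let i = a * 2 ^ d + b
     in if i < length vs then of_rat (vs ! i) else 0"]) (simp add: Let_def)

lemma abs_dyadic_step_le: "\<bar>dyadic_step d vs z\<bar> \<le> (\<Sum>v\<leftarrow>vs. \<bar>of_rat v\<bar>)"
proof -
  have "\<bar>of_rat (vs ! i) :: real\<bar> \<le> (\<Sum>v\<leftarrow>vs. \<bar>of_rat v\<bar>)" if "i < length vs" for i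
    using that by (intro member_le_sum_list) auto
  moreover have "(0::real) \<le> (\<Sum>v\<leftarrow>vs. \<bar>of_rat v\<bar>)"
    by (intro sum_list_nonneg) auto
  ultimately show ?thesis by (auto simp: dyadic_step_def Let_def)
qed

text \<open>Points with a coordinate 1 are assigned to index 0 by \<open>dyadic_index\<close>, far
  from their true position. Approximation by values at cell corners is valid only off these two
  edges, which are null.\<close>

lemma AE_square_half_open: "AE z in square_measure. fst z < 1 \<and> snd z < 1"
proof -
  have "negligible {z :: real \<times> real. z \<bullet> (1, 0) = 1}" "negligible {z :: real \<times> real. z \<bullet> (0, 1) = 1}"
    by (intro negligible_standard_hyperplane; simp add: Basis_prod_def)+
  then have "AE z in lebesgue. z \<notin> {z :: real \<times> real. z \<bullet> (1, 0) = 1}"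
    "AE z in lebesgue. z \<notin> {z :: real \<times> real. z \<bullet> (0, 1) = 1}"
    unfolding negligible_iff_null_sets by (blast intro: AE_not_in)+
  then show ?thesis
    by (subst AE_restrict_space_iff) (auto simp: inner_prod_def)
qed

lemma dist_dyadic_corner:
  assumes "0 \<le> x" "x < 1"
  shows "\<bar>x - real (dyadic_index d x) / 2 ^ d\<bar> < 1 / 2 ^ d"
    and "real (dyadic_index d x) / 2 ^ d \<in> {0..1}"
proof -
  have "0 \<le> \<lfloor>2 ^ d * x\<rfloor>" "\<lfloor>2 ^ d * x\<rfloor> < 2 ^ d"
    using assms by (auto simp: floor_less_iff)
  then have "real (dyadic_index d x) = of_int \<lfloor>2 ^ d * x\<rfloor>"
    by (simp add: dyadic_index_def)
  then have "\<bar>2 ^ d * x - real (dyadic_index d x)\<bar> < 1" by linarith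
  moreover have "x - real (dyadic_index d x) / 2 ^ d = (2 ^ d * x - real (dyadic_index d x)) / 2 ^ d"
    by (simp add: field_simps)
  ultimately show "\<bar>x - real (dyadic_index d x) / 2 ^ d\<bar> < 1 / 2 ^ d"
    by (simp add: abs_divide divide_strict_right_mono)
  show "real (dyadic_index d x) / 2 ^ d \<in> {0..1}"
  proof -
    have "real (dyadic_index d x) < real (2 ^ d)"
      using dyadic_index_less by (rule iffD2[OF of_nat_less_iff])
    then show ?thesis by simp
  qed
qed

text \<open>By uniform continuity g varies by less than \<eta> / 2 between a point and the lower
  left corner of its cell, if the level d is large; rounding the corner value to a rational costs
  another \<eta> / 2.\<close>

lemma continuous_dyadic_step_approx:
  fixes g :: "real \<times> real \<Rightarrow> real"
  assumes "continuous_on unit_square g" "0 < \<eta>"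
  obtains d vs where "\<And>z. z \<in> {0..<1} \<times> {0..<1} \<Longrightarrow> \<bar>g z - dyadic_step d vs z\<bar> \<le> \<eta>"
proof -
  have "uniformly_continuous_on unit_square g"
    using assms(1) by (intro compact_uniformly_continuous compact_Times) auto
  then obtain \<delta> where \<delta>: "\<delta> > 0"
    "\<And>z w. z \<in> unit_square \<Longrightarrow> w \<in> unit_square \<Longrightarrow> dist z w < \<delta> \<Longrightarrow> dist (g z) (g w) < \<eta> / 2"
    using assms(2) unfolding uniformly_continuous_on_def by (metis half_gt_zero dist_commute)
  obtain d :: nat where "(1/2) ^ d < \<delta> / 2"
    using real_arch_pow_inv[of "\<delta> / 2" "1/2"] \<delta>(1) by auto
  then have d: "2 * (1/2) ^ d < \<delta>" by simp
  have "\<exists>q. \<bar>y - of_rat q\<bar> < \<eta> / 2" for y :: real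
  proof -
    obtain q where "y < of_rat q" "of_rat q < y + \<eta> / 2"
      using of_rat_dense[of y "y + \<eta> / 2"] assms(2) by auto
    then have "\<bar>y - of_rat q\<bar> < \<eta> / 2" by linarith
    then show ?thesis by blast
  qed
  then obtain q where q: "\<And>y. \<bar>y - of_rat (q y)\<bar> < \<eta> / 2" by metis
  define c where "c a b = (real a / 2 ^ d, real b / 2 ^ d)" for a b :: nat
  \<comment> \<open>Position i of the row-major list belongs to the cell in row
    \<open>i div 2 ^ d\<close> and column \<open>i mod 2 ^ d\<close>.\<close>
  define vs where "vs = map (\<lambda>i. q (g (c (i div 2 ^ d) (i mod 2 ^ d)))) [0..<2 ^ d * 2 ^ d]"
  have "\<bar>g z - dyadic_step d vs z\<bar> \<le> \<eta>" if z: "z \<in> {0..<1} \<times> {0..<1}" for z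
  proof -
    let ?a = "dyadic_index d (fst z)" and ?b = "dyadic_index d (snd z)"
    let ?i = "?a * 2 ^ d + ?b"
    have ab: "?a < 2 ^ d" "?b < 2 ^ d" by (rule dyadic_index_less)+
    have i: "?i < 2 ^ d * 2 ^ d"
    proof -
      have "?i < (?a + 1) * 2 ^ d" using ab by simp
      also have "\<dots> \<le> 2 ^ d * 2 ^ d" using ab by (intro mult_right_mono) auto
      finally show ?thesis .
    qed
    have "?i div 2 ^ d = ?a" "?i mod 2 ^ d = ?b" using ab by auto
    then have step: "dyadic_step d vs z = of_rat (q (g (c ?a ?b)))"
      using i by (simp add: dyadic_step_def vs_def Let_def)
    have "dist z (c ?a ?b) \<le> \<bar>fst z - fst (c ?a ?b)\<bar> + \<bar>snd z - snd (c ?a ?b)\<bar>"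
      unfolding dist_prod_def dist_real_def by (rule order_trans[OF sqrt_sum_squares_le_sum_abs]) simp
    also have "\<dots> < 1 / 2 ^ d + 1 / 2 ^ d"
      unfolding c_def fst_conv snd_conv using z by (intro add_strict_mono dist_dyadic_corner) auto
    also have "\<dots> < \<delta>" using d by (simp add: power_divide)
    finally have "dist z (c ?a ?b) < \<delta>" .
    moreover have "c ?a ?b \<in> unit_square"
      using z dist_dyadic_corner(2)[of "fst z" d] dist_dyadic_corner(2)[of "snd z" d]
      by (auto simp: c_def mem_Times_iff)
    moreover have "z \<in> unit_square" using z by auto
    ultimately have "dist (g z) (g (c ?a ?b)) < \<eta> / 2" by (intro \<delta>)
    then show ?thesis using q[of "g (c ?a ?b)"] unfolding step dist_real_def by linarith
  qed
  then show ?thesis by (rule that)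
qed

lemma weighted_integral_mono_AE:
  assumes "weight \<mu>" "f \<in> weighted_L1 \<mu>" "AE z in square_measure. \<bar>f z\<bar> \<le> \<eta>" "0 \<le> \<eta>"
  shows "weighted_integral \<mu> f \<le> \<eta>"
proof -
  have "weighted_integral \<mu> f \<le> (LINT z|square_measure. \<eta>)"
    unfolding weighted_integral_def
  proof (rule integral_mono_AE)
    show "integrable square_measure (\<lambda>z. \<bar>f z\<bar> * \<mu> z)" using assms by (simp add: weighted_L1_iff)
    have "AE z in square_measure. z \<in> unit_square" by (rule AE_I2) simp
    with assms(3) show "AE z in square_measure. \<bar>f z\<bar> * \<mu> z \<le> \<eta>"
    proof eventually_elim
      case (elim z)
      then have "\<bar>f z\<bar> * \<mu> z \<le> \<eta> * 1"
        using weightD(2,3)[OF assms(1)] assms(4) by (intro mult_mono) auto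
      then show ?case by simp
    qed
  qed simp
  then show ?thesis by simp
qed

text \<open>Three errors below or equal to \<delta> / 3 add up: truncation of f at height n,
  approximation of the truncated function by a continuous one, and approximation of that by a step
  function. The first two are limits by dominated convergence.\<close>

lemma dyadic_step_dense:
  assumes \<mu>: "weight \<mu>" and f: "f \<in> weighted_L1 \<mu>" and "0 < \<delta>"
  obtains d vs where "weighted_integral \<mu> (\<lambda>z. f z - dyadic_step d vs z) < \<delta>"
proof -
  note [measurable] = weightD(1)[OF \<mu>]
  have [measurable]: "f \<in> borel_measurable square_measure"
    and int: "integrable square_measure (\<lambda>z. \<bar>f z\<bar> * \<mu> z)"
    using f \<mu> by (simp_all add: weighted_L1_iff)
  define clip where "clip B x = max (- B) (min B x)" for B x :: real
  have clip_cont: "continuous_on UNIV (clip B)" for B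
    unfolding clip_def by (intro continuous_intros)
  have [measurable]: "clip B \<in> borel_measurable borel" for B
    using clip_cont by (rule borel_measurable_continuous_onI)
  have clip_bd: "\<bar>clip B x\<bar> \<le> B" if "0 \<le> B" for B x using that by (auto simp: clip_def)
  have "(\<lambda>n. LINT z|square_measure. \<bar>f z - clip (real n) (f z)\<bar> * \<mu> z) \<longlonglongrightarrow> (LINT z|square_measure. 0)"
  proof (rule integral_dominated_convergence[OF _ _ int])
    have "(\<lambda>n. \<bar>f z - clip (real n) (f z)\<bar> * \<mu> z) \<longlonglongrightarrow> 0" for z
    proof (rule tendsto_eventually)
      obtain k :: nat where "\<bar>f z\<bar> \<le> real k" using real_arch_simple by blast
      then have "\<bar>f z - clip (real n) (f z)\<bar> * \<mu> z = 0" if "n \<ge> k" for n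
        using that by (simp add: clip_def max_def min_def abs_le_iff)
      then show "\<forall>\<^sub>F n in sequentially. \<bar>f z - clip (real n) (f z)\<bar> * \<mu> z = 0"
        by (auto simp: eventually_sequentially)
    qed
    then show "AE z in square_measure. (\<lambda>n. \<bar>f z - clip (real n) (f z)\<bar> * \<mu> z) \<longlonglongrightarrow> 0" by simp
    fix n
    show "AE z in square_measure. norm (\<bar>f z - clip (real n) (f z)\<bar> * \<mu> z) \<le> \<bar>f z\<bar> * \<mu> z"
    proof (rule AE_I2)
      fix z assume "z \<in> space square_measure"
      then have "0 \<le> \<mu> z" using weightD(2)[OF \<mu>] by simp
      moreover have "\<bar>f z - clip (real n) (f z)\<bar> \<le> \<bar>f z\<bar>" by (auto simp: clip_def)
      ultimately show "norm (\<bar>f z - clip (real n) (f z)\<bar> * \<mu> z) \<le> \<bar>f z\<bar> * \<mu> z"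
        by (simp add: abs_mult mult_right_mono)
    qed
  qed measurable
  then have "(\<lambda>n. weighted_integral \<mu> (\<lambda>z. f z - clip (real n) (f z))) \<longlonglongrightarrow> 0"
    by (simp add: weighted_integral_def)
  then have "\<forall>\<^sub>F n in sequentially. weighted_integral \<mu> (\<lambda>z. f z - clip (real n) (f z)) < \<delta> / 3"
    using \<open>0 < \<delta>\<close> by (intro order_tendstoD) auto
  then obtain n where n: "weighted_integral \<mu> (\<lambda>z. f z - clip (real n) (f z)) < \<delta> / 3"
    by (auto simp: eventually_sequentially)
  define u where "u z = clip (real n) (f z)" for z
  have [measurable]: "u \<in> borel_measurable square_measure" unfolding u_def[abs_def] by measurable
  have u: "u \<in> weighted_L1 \<mu>"
    by (rule weighted_L1_bounded[OF \<mu>, of _ "real n"]) (auto simp: u_def clip_bd)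
  \<comment> \<open>Lebesgue measurability in this form supplies continuous functions that converge
    to u off a negligible set.\<close>
  have "u measurable_on unit_square"
    by (simp add: measurable_on_iff_borel_measurable)
  then obtain Z g where Z: "negligible Z" and g: "\<And>k. continuous_on UNIV (g k)"
    "\<And>x. x \<notin> Z \<Longrightarrow> (\<lambda>k. g k x) \<longlonglongrightarrow> (if x \<in> unit_square then u x else 0)"
    unfolding measurable_on_def by blast
  \<comment> \<open>Clipping the continuous functions gives the constant majorant 2n for dominated
    convergence. It does not disturb the limit, because u is already clipped at the same
    height.\<close>
  define w where "w k z = clip (real n) (g k z)" for k z
  have w_cont: "continuous_on UNIV (w k)" for k
    unfolding w_def using continuous_on_compose2[OF clip_cont g(1)] by simp
  have w_meas [measurable]: "w k \<in> borel_measurable square_measure" for k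
    using w_cont by (intro borel_imp_square_measurable borel_measurable_continuous_onI)
  have w: "w k \<in> weighted_L1 \<mu>" for k
    by (rule weighted_L1_bounded[OF \<mu>, of _ "real n"]) (auto simp: w_def clip_bd)
  have "(\<lambda>k. LINT z|square_measure. \<bar>u z - w k z\<bar> * \<mu> z) \<longlonglongrightarrow> (LINT z|square_measure. 0)"
  proof (rule integral_dominated_convergence[where w = "\<lambda>_. 2 * real n"])
    have "AE z in lebesgue. z \<notin> Z"
      using Z unfolding negligible_iff_null_sets by (rule AE_not_in)
    then have "AE z in square_measure. z \<notin> Z \<and> z \<in> unit_square"
      by (subst AE_restrict_space_iff) auto
    then show "AE z in square_measure. (\<lambda>k. \<bar>u z - w k z\<bar> * \<mu> z) \<longlonglongrightarrow> 0"
    proof eventually_elim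
      case (elim z)
      have "isCont (clip (real n)) (u z)"
        using clip_cont by (simp add: continuous_on_eq_continuous_at)
      moreover have "(\<lambda>k. g k z) \<longlonglongrightarrow> u z" using g(2)[of z] elim by simp
      ultimately have "(\<lambda>k. w k z) \<longlonglongrightarrow> clip (real n) (u z)"
        unfolding w_def by (rule isCont_tendsto_compose)
      moreover have "clip (real n) (u z) = u z" by (auto simp: u_def clip_def)
      ultimately have "(\<lambda>k. \<bar>u z - w k z\<bar> * \<mu> z) \<longlonglongrightarrow> \<bar>u z - u z\<bar> * \<mu> z"
        by (intro tendsto_intros) simp
      then show ?case by simp
    qed
    fix k
    show "AE z in square_measure. norm (\<bar>u z - w k z\<bar> * \<mu> z) \<le> 2 * real n"
    proof (rule AE_I2)
      fix z assume "z \<in> space square_measure"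
      then have \<mu>z: "0 \<le> \<mu> z" "\<mu> z \<le> 1" using weightD(2,3)[OF \<mu>] by auto
      have "\<bar>u z - w k z\<bar> \<le> 2 * real n"
        using clip_bd[of "real n" "f z"] clip_bd[of "real n" "g k z"] by (simp add: u_def w_def)
      then have "\<bar>u z - w k z\<bar> * \<mu> z \<le> 2 * real n * 1" using \<mu>z by (intro mult_mono) auto
      then show "norm (\<bar>u z - w k z\<bar> * \<mu> z) \<le> 2 * real n" using \<mu>z by (simp add: abs_mult)
    qed
  qed (auto intro!: sq.integrable_const)
  then have "(\<lambda>k. weighted_integral \<mu> (\<lambda>z. u z - w k z)) \<longlonglongrightarrow> 0"
    by (simp add: weighted_integral_def)
  then have "\<forall>\<^sub>F k in sequentially. weighted_integral \<mu> (\<lambda>z. u z - w k z) < \<delta> / 3"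
    using \<open>0 < \<delta>\<close> by (intro order_tendstoD) auto
  then obtain k where k: "weighted_integral \<mu> (\<lambda>z. u z - w k z) < \<delta> / 3"
    by (auto simp: eventually_sequentially)
  obtain d vs where dvs: "\<And>z. z \<in> {0..<1} \<times> {0..<1} \<Longrightarrow> \<bar>w k z - dyadic_step d vs z\<bar> \<le> \<delta> / 3"
    using continuous_dyadic_step_approx[of "w k" "\<delta> / 3"] continuous_on_subset[OF w_cont] \<open>0 < \<delta>\<close>
    by (metis subset_UNIV zero_less_divide_iff zero_less_numeral)
  have s: "dyadic_step d vs \<in> weighted_L1 \<mu>"
    using weighted_L1_bounded[OF \<mu> borel_imp_square_measurable[OF borel_measurable_dyadic_step]]
      abs_dyadic_step_le by blast
  have ws: "weighted_integral \<mu> (\<lambda>z. w k z - dyadic_step d vs z) \<le> \<delta> / 3"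
  proof (rule weighted_integral_mono_AE[OF \<mu>])
    show "(\<lambda>z. w k z - dyadic_step d vs z) \<in> weighted_L1 \<mu>"
      by (rule weighted_L1_diff[OF \<mu> w s])
    have "AE z in square_measure. z \<in> unit_square" by (rule AE_I2) simp
    with AE_square_half_open show "AE z in square_measure. \<bar>w k z - dyadic_step d vs z\<bar> \<le> \<delta> / 3"
      by eventually_elim (rule dvs, auto)
  qed (use \<open>0 < \<delta>\<close> in simp)
  have "weighted_integral \<mu> (\<lambda>z. f z - dyadic_step d vs z)
      = weighted_integral \<mu> (\<lambda>z. (f z - u z) + ((u z - w k z) + (w k z - dyadic_step d vs z)))"
    by simp
  also have "\<dots> \<le> weighted_integral \<mu> (\<lambda>z. f z - u z) +
      weighted_integral \<mu> (\<lambda>z. (u z - w k z) + (w k z - dyadic_step d vs z))"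
    by (intro weighted_L1_add(2) weighted_L1_add(1) weighted_L1_diff(1) \<mu> f u w s)
  also have "\<dots> \<le> weighted_integral \<mu> (\<lambda>z. f z - u z) +
      (weighted_integral \<mu> (\<lambda>z. u z - w k z) + weighted_integral \<mu> (\<lambda>z. w k z - dyadic_step d vs z))"
    by (intro add_left_mono weighted_L1_add(2) weighted_L1_diff(1) \<mu> u w s)
  also have "\<dots> < \<delta>" using n k ws unfolding u_def by simp
  finally show ?thesis by (rule that)
qed

section \<open>Greedy rearrangement\<close>

lemma finite_disjoint_meets:
  assumes "finite F" "\<And>s t. s \<noteq> t \<Longrightarrow> B s \<inter> B t = {}"
  shows "finite {s. B s \<inter> F \<noteq> {}}"
proof -
  have "{s. B s \<inter> F \<noteq> {}} = (\<Union>p\<in>F. {s. p \<in> B s})" by auto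
  moreover have "finite {s. p \<in> B s}" for p
  proof (cases "\<exists>s. p \<in> B s")
    case True
    then obtain s where "p \<in> B s" by blast
    then have "{s. p \<in> B s} \<subseteq> {s}" using assms(2) by blast
    then show ?thesis by (rule finite_subset) simp
  qed simp
  ultimately show ?thesis using assms(1) by simp
qed

text \<open>Let r be the current residual. The block is chosen to approximate r - h j, so after it
  the residual is this approximation error plus the error of the block itself. While the block is
  being appended, its prefix costs at most N of the step function, which is at most N r + N (h j) +
  (1/2)^i; adding the N of r - h j explains the factors 2.\<close>

lemma greedy_step:
  fixes N :: "'v::ab_group_add \<Rightarrow> real" and h :: "'i \<Rightarrow> 'v"
  assumes diff: "\<And>u v. u \<in> V \<Longrightarrow> v \<in> V \<Longrightarrow> u - v \<in> V"
    and sum_V: "\<And>l. set l \<subseteq> A \<Longrightarrow> sum_list (map h l) \<in> V"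
    and phi: "\<And>s. \<phi> s \<in> V"
    and triangle: "\<And>u v. u \<in> V \<Longrightarrow> v \<in> V \<Longrightarrow> N (u - v) \<le> N u + N v"
    and triangle': "\<And>u v. u \<in> V \<Longrightarrow> v \<in> V \<Longrightarrow> N (u + v) \<le> N u + N v"
    and L: "\<And>s. distinct (L s)" "\<And>s. set (L s) \<subseteq> A"
      "\<And>s t. s \<noteq> t \<Longrightarrow> set (L s) \<inter> set (L t) = {}"
    and prefix: "\<And>s t. s \<ge> start \<Longrightarrow> N (sum_list (map h (take t (L s)))) \<le> N (\<phi> s) + (1/2) ^ s"
    and full: "\<And>s. s \<ge> start \<Longrightarrow> N (\<phi> s - sum_list (map h (L s))) \<le> (1/2) ^ s"
    and dense: "\<And>u \<delta> n. u \<in> V \<Longrightarrow> \<delta> > 0 \<Longrightarrow> \<exists>s\<ge>n. N (u - \<phi> s) < \<delta>"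
    and f: "f \<in> V" and l: "distinct l" "set l \<subseteq> A" and j: "j \<in> A" "j \<notin> set l"
  shows "\<exists>B. distinct (l @ j # B) \<and> set B \<subseteq> A \<and>
    N (f - sum_list (map h (l @ j # B))) \<le> 2 * (1/2) ^ i \<and>
    (\<forall>t. N (f - sum_list (map h (l @ j # take t B)))
          \<le> 2 * N (f - sum_list (map h l)) + 2 * N (h j) + 2 * (1/2) ^ i)"
proof -
  define r where "r = f - sum_list (map h l)"
  have rV: "r \<in> V" unfolding r_def using f l by (intro diff sum_V)
  have hV: "h j \<in> V" using sum_V[of "[j]"] j by simp
  have "finite {s. set (L s) \<inter> insert j (set l) \<noteq> {}}"
  proof (rule finite_disjoint_meets)
    show "finite (insert j (set l))" by simp
    show "set (L s) \<inter> set (L t) = {}" if "s \<noteq> t" for s t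
      using that by (rule L(3))
  qed
  then have "\<exists>b. \<forall>s\<in>{s. set (L s) \<inter> insert j (set l) \<noteq> {}}. s < b"
    by (rule iffD1[OF finite_nat_set_iff_bounded])
  then obtain b where b: "set (L s) \<inter> insert j (set l) \<noteq> {} \<Longrightarrow> s < b" for s
    by blast
  \<comment> \<open>Beyond b the block is disjoint from the terms used so far, beyond i its own
    errors are below (1/2)^i, and beyond \<open>start\<close> the bounds on blocks are
    available.\<close>
  obtain s where s: "s \<ge> max b (max i start)" "N (r - h j - \<phi> s) < (1/2) ^ i"
    using dense[OF diff[OF rV hV], of "(1/2) ^ i" "max b (max i start)"] by auto
  have disj: "set (L s) \<inter> insert j (set l) = {}" using b[of s] s(1) by force
  have pow: "(1/2 :: real) ^ s \<le> (1/2) ^ i"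
    using s(1) by (intro power_decreasing) auto
  have xV: "r - h j - \<phi> s \<in> V" by (intro diff rV hV phi)
  have LV: "sum_list (map h (take t (L s))) \<in> V" for t
    using L(2)[of s] set_take_subset[of t "L s"] by (intro sum_V) auto
  have LV': "sum_list (map h (L s)) \<in> V"
    using L(2)[of s] by (intro sum_V)
  show ?thesis
  proof (intro exI[of _ "L s"] conjI allI)
    show "distinct (l @ j # L s)" using disj L(1) l j by auto
    show "set (L s) \<subseteq> A" by (rule L)
    have eq: "f - sum_list (map h (l @ j # L s)) = (r - h j - \<phi> s) + (\<phi> s - sum_list (map h (L s)))"
      by (simp add: r_def algebra_simps)
    have "N (f - sum_list (map h (l @ j # L s)))
        \<le> N (r - h j - \<phi> s) + N (\<phi> s - sum_list (map h (L s)))"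
      unfolding eq by (intro triangle' xV diff phi LV')
    then show "N (f - sum_list (map h (l @ j # L s))) \<le> 2 * (1/2) ^ i"
      using full[of s] pow s by linarith
    fix t
    have "N (\<phi> s) = N ((r - h j) - (r - h j - \<phi> s))" by simp
    also have "\<dots> \<le> N (r - h j) + N (r - h j - \<phi> s)"
      by (intro triangle diff rV hV phi)
    also have "N (r - h j) \<le> N r + N (h j)" by (intro triangle rV hV)
    finally have phi_le: "N (\<phi> s) \<le> N r + N (h j) + (1/2) ^ i" using s(2) by simp
    have eq': "f - sum_list (map h (l @ j # take t (L s))) = (r - h j) - sum_list (map h (take t (L s)))"
      by (simp add: r_def algebra_simps)
    have "N (f - sum_list (map h (l @ j # take t (L s))))
        \<le> N (r - h j) + N (sum_list (map h (take t (L s))))"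
      unfolding eq' by (intro triangle diff rV hV LV)
    also have "N (r - h j) \<le> N r + N (h j)" by (intro triangle rV hV)
    also have "N (sum_list (map h (take t (L s)))) \<le> N (\<phi> s) + (1/2) ^ s"
      using s(1) by (intro prefix) auto
    finally show "N (f - sum_list (map h (l @ j # take t (L s))))
          \<le> 2 * N (f - sum_list (map h l)) + 2 * N (h j) + 2 * (1/2) ^ i"
      using phi_le pow unfolding r_def by linarith
  qed
qed

lemma greedy_rearrangement:
  fixes N :: "'v::ab_group_add \<Rightarrow> real" and h :: "'i \<Rightarrow> 'v"
  assumes A: "countable A" "infinite A"
    and diff: "\<And>u v. u \<in> V \<Longrightarrow> v \<in> V \<Longrightarrow> u - v \<in> V"
    and sum_V: "\<And>l. set l \<subseteq> A \<Longrightarrow> sum_list (map h l) \<in> V"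
    and phi: "\<And>s. \<phi> s \<in> V"
    and nonneg: "\<And>u. 0 \<le> N u"
    and triangle: "\<And>u v. u \<in> V \<Longrightarrow> v \<in> V \<Longrightarrow> N (u - v) \<le> N u + N v"
    and triangle': "\<And>u v. u \<in> V \<Longrightarrow> v \<in> V \<Longrightarrow> N (u + v) \<le> N u + N v"
    and small: "\<And>\<delta>. \<delta> > 0 \<Longrightarrow> finite {p \<in> A. \<delta> \<le> N (h p)}"
    and L: "\<And>s. distinct (L s)" "\<And>s. set (L s) \<subseteq> A"
      "\<And>s t. s \<noteq> t \<Longrightarrow> set (L s) \<inter> set (L t) = {}"
    and prefix: "\<And>s t. s \<ge> start \<Longrightarrow> N (sum_list (map h (take t (L s)))) \<le> N (\<phi> s) + (1/2) ^ s"
    and full: "\<And>s. s \<ge> start \<Longrightarrow> N (\<phi> s - sum_list (map h (L s))) \<le> (1/2) ^ s"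
    and dense: "\<And>u \<delta> n. u \<in> V \<Longrightarrow> \<delta> > 0 \<Longrightarrow> \<exists>s\<ge>n. N (u - \<phi> s) < \<delta>"
    and f: "f \<in> V"
  obtains \<pi> :: "nat \<Rightarrow> 'i" where "bij_betw \<pi> UNIV A"
    "(\<lambda>n. N (f - (\<Sum>j<n. h (\<pi> j)))) \<longlonglongrightarrow> 0"
proof -
  obtain e :: "nat \<Rightarrow> 'i" where e: "bij_betw e UNIV A"
    using A bij_betw_from_nat_into by blast
  define nxt where "nxt l = e (LEAST n. e n \<notin> set l)" for l
  have ex: "\<exists>n. e n \<notin> set l" for l
  proof (rule ccontr)
    assume "\<not> ?thesis"
    then have "A \<subseteq> set l" using e by (auto simp: bij_betw_def)
    with A(2) show False using finite_subset by blast
  qed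
  have nxt: "nxt l \<in> A" "nxt l \<notin> set l" for l
    unfolding nxt_def using e LeastI_ex[OF ex] by (auto simp: bij_betw_def)
  define r where "r l = N (f - sum_list (map h l))" for l
  define good where "good i l B \<longleftrightarrow> distinct (l @ nxt l # B) \<and> set B \<subseteq> A \<and>
      r (l @ nxt l # B) \<le> 2 * (1/2) ^ i \<and>
      (\<forall>t. r (l @ nxt l # take t B) \<le> 2 * r l + 2 * N (h (nxt l)) + 2 * (1/2) ^ i)" for i :: nat and l B
  have good_ex: "\<exists>B. good i l B" if "distinct l" "set l \<subseteq> A" for i l
    unfolding good_def r_def
    by (rule greedy_step[where V = V and A = A and \<phi> = \<phi> and L = L and start = start])
      (fact diff sum_V phi triangle triangle' L prefix full dense f that nxt)+
  define ls where "ls = rec_nat [] (\<lambda>i l. l @ nxt l # (SOME B. good i l B))"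
  define B where "B i = (SOME B. good i (ls i) B)" for i
  define j where "j i = nxt (ls i)" for i
  have ls0: "ls 0 = []" and lsS: "ls (Suc i) = ls i @ j i # B i" for i
    by (simp_all add: ls_def B_def j_def)
  have inv: "distinct (ls i) \<and> set (ls i) \<subseteq> A" for i
  proof (induction i)
    case (Suc i)
    then have "good i (ls i) (B i)"
      unfolding B_def using good_ex[of "ls i" i] by (blast intro: someI_ex)
    then show ?case using Suc nxt[of "ls i"] by (auto simp: lsS good_def j_def)
  qed (simp add: ls0)
  have good: "good i (ls i) (B i)" for i
    unfolding B_def using good_ex[of "ls i" i] inv[of i] by (blast intro: someI_ex)
  have mono: "i \<le> k \<Longrightarrow> \<exists>ys. ls k = ls i @ ys" for i k
    by (induction rule: dec_induct) (auto simp: lsS)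
  have len: "i \<le> length (ls i)" for i
    by (induction i) (auto simp: lsS)
  \<comment> \<open>If the first i elements of the enumeration are present and \<open>e i\<close> is
    missing, then \<open>e i\<close> is exactly what stage i forces.\<close>
  have cover: "e ` {..<i} \<subseteq> set (ls i)" for i
  proof (induction i)
    case (Suc i)
    have "e i \<in> set (ls (Suc i))"
    proof (cases "e i \<in> set (ls i)")
      case False
      then have "(LEAST n. e n \<notin> set (ls i)) = i"
        using Suc by (intro Least_equality) (auto simp: not_less[symmetric])
      then show ?thesis by (simp add: lsS j_def nxt_def)
    qed (simp add: lsS)
    then show ?case using Suc by (auto simp: lsS lessThan_Suc)
  qed simp
  \<comment> \<open>Stage \<open>Suc n\<close> is long enough to read off entry n, because each
    stage appends at least one term; later stages only extend the list.\<close>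
  define \<pi> where "\<pi> n = ls (Suc n) ! n" for n
  have \<pi>: "\<pi> n = ls i ! n" if "n < length (ls i)" for n i
  proof -
    have n: "n < length (ls (Suc n))" using len[of "Suc n"] by simp
    show ?thesis
    proof (cases "i \<le> Suc n")
      case True
      then obtain ys where "ls (Suc n) = ls i @ ys" using mono by blast
      then show ?thesis using that by (simp add: \<pi>_def nth_append)
    next
      case False
      then obtain ys where "ls i = ls (Suc n) @ ys" using mono[of "Suc n" i] by auto
      then show ?thesis using n by (simp add: \<pi>_def nth_append)
    qed
  qed
  have take_ls: "map \<pi> [0..<n] = take n (ls i)" if "n \<le> length (ls i)" for n i
    by (rule nth_equalityI) (use that \<pi> in auto)
  have "bij_betw \<pi> UNIV A"
    unfolding bij_betw_def
  proof
    show "inj \<pi>"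
    proof (rule injI)
      fix m n assume eq: "\<pi> m = \<pi> n"
      let ?k = "Suc (max m n)"
      have "m < length (ls ?k)" "n < length (ls ?k)" using len[of ?k] by auto
      then show "m = n"
        using eq inv[of ?k] by (metis \<pi> nth_eq_iff_index_eq)
    qed
    show "range \<pi> = A"
    proof
      show "range \<pi> \<subseteq> A"
      proof
        fix x assume "x \<in> range \<pi>"
        then obtain n where "x = \<pi> n" by blast
        then show "x \<in> A"
          using len[of "Suc n"] inv[of "Suc n"] nth_mem[of n "ls (Suc n)"] by (auto simp: \<pi>_def)
      qed
      show "A \<subseteq> range \<pi>"
      proof
        fix x assume "x \<in> A"
        then obtain i where "x = e i" using e by (auto simp: bij_betw_def)
        then have "x \<in> set (ls (Suc i))" using cover[of "Suc i"] by auto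
        then obtain n where "n < length (ls (Suc i))" "x = ls (Suc i) ! n"
          by (metis in_set_conv_nth)
        then show "x \<in> range \<pi>" by (metis \<pi> rangeI)
      qed
    qed
  qed
  moreover have "(\<lambda>n. N (f - (\<Sum>j<n. h (\<pi> j)))) \<longlonglongrightarrow> 0"
  proof -
    have S: "(\<Sum>j<n. h (\<pi> j)) = sum_list (map h (map \<pi> [0..<n]))" for n
      by (simp add: interv_sum_list_conv_sum_set_nat lessThan_atLeast0 comp_def)
    \<comment> \<open>Bounds the error of every partial sum belonging to stage i, including the one
      at its start.\<close>
    define b where "b i = 2 * r (ls i) + 2 * N (h (j i)) + 2 * (1/2) ^ i" for i
    have j_in: "j i \<in> A" "j i \<notin> set (ls i)" for i
      using nxt by (auto simp: j_def)
    have "j i \<noteq> j k" if "i < k" for i k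
    proof -
      from mono[OF Suc_leI[OF that]] obtain ys where "ls k = ls (Suc i) @ ys" by blast
      then have "j i \<in> set (ls k)" by (simp add: lsS)
      then show ?thesis using j_in by metis
    qed
    then have "inj j" by (metis injI linorder_neqE_nat)
    have "(\<lambda>i. N (h (j i))) \<longlonglongrightarrow> 0"
    proof (rule LIMSEQ_I)
      fix \<delta> :: real assume "0 < \<delta>"
      have "finite (j -` {p \<in> A. \<delta> \<le> N (h p)})"
        using small[OF \<open>0 < \<delta>\<close>] \<open>inj j\<close> by (rule finite_vimageI)
      then have "\<exists>n. \<forall>i \<in> j -` {p \<in> A. \<delta> \<le> N (h p)}. i < n"
        by (rule iffD1[OF finite_nat_set_iff_bounded])
      then obtain n where "\<And>i. i \<in> j -` {p \<in> A. \<delta> \<le> N (h p)} \<Longrightarrow> i < n"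
        by blast
      then have "\<forall>i\<ge>n. norm (N (h (j i)) - 0) < \<delta>"
        using j_in nonneg by (force simp: not_le)
      then show "\<exists>n. \<forall>i\<ge>n. norm (N (h (j i)) - 0) < \<delta>" by blast
    qed
    moreover have rlim: "(\<lambda>i. r (ls i)) \<longlonglongrightarrow> 0"
    proof (rule LIMSEQ_imp_Suc, rule tendsto_sandwich)
      show "\<forall>\<^sub>F i in sequentially. 0 \<le> r (ls (Suc i))" by (simp add: r_def nonneg)
      show "\<forall>\<^sub>F i in sequentially. r (ls (Suc i)) \<le> 2 * (1/2) ^ i"
        using good by (auto simp: good_def lsS j_def)
      show "(\<lambda>i. 2 * (1/2) ^ i :: real) \<longlonglongrightarrow> 0"
        by (intro tendsto_mult_right_zero LIMSEQ_realpow_zero) auto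
    qed simp
    moreover have "(\<lambda>i. (1/2) ^ i :: real) \<longlonglongrightarrow> 0"
      by (intro LIMSEQ_realpow_zero) auto
    ultimately have "b \<longlonglongrightarrow> 2 * 0 + 2 * 0 + 2 * 0"
      unfolding b_def by (intro tendsto_add tendsto_mult_left)
    then have blim: "b \<longlonglongrightarrow> 0" by simp
    have b_ge: "r (ls i) \<le> b i" for i
      by (simp add: b_def r_def nonneg)
    show ?thesis
    proof (rule LIMSEQ_I)
      fix \<delta> :: real assume "0 < \<delta>"
      then obtain K where K: "\<And>i. i \<ge> K \<Longrightarrow> b i < \<delta>"
        using LIMSEQ_D[OF blim, of \<delta>] by (auto simp: abs_less_iff)
      have "N (f - (\<Sum>j<n. h (\<pi> j))) < \<delta>" if n: "n \<ge> length (ls K)" for n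
      proof -
        \<comment> \<open>The stage during which the partial sum of length n is formed: it is the
          last one that starts at or before n.\<close>
        define i where "i = (GREATEST i. length (ls i) \<le> n)"
        have bd: "length (ls i) \<le> n \<Longrightarrow> i \<le> n" for i using len[of i] by simp
        have i1: "length (ls i) \<le> n"
          unfolding i_def using n bd by (rule GreatestI_nat)
        have iK: "K \<le> i"
          unfolding i_def using n bd by (rule Greatest_le_nat)
        have i2: "n < length (ls (Suc i))"
        proof (rule ccontr)
          assume "\<not> ?thesis"
          then have "Suc i \<le> i"
            unfolding i_def using bd by (intro Greatest_le_nat) auto
          then show False by simp
        qed
        have "map \<pi> [0..<n] = take n (ls (Suc i))" using i2 by (intro take_ls) simp
        also have "\<dots> = ls i @ take (n - length (ls i)) (j i # B i)"
          using i1 by (simp add: lsS)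
        finally have eq: "N (f - (\<Sum>j<n. h (\<pi> j))) = r (ls i @ take (n - length (ls i)) (j i # B i))"
          by (simp only: S r_def)
        show ?thesis
        proof (cases "n - length (ls i)")
          case 0
          then show ?thesis using eq b_ge[of i] K[OF iK] by simp
        next
          case (Suc t)
          have "r (ls i @ j i # take t (B i)) \<le> b i"
            using good[of i] by (simp add: good_def b_def j_def)
          then show ?thesis using eq Suc K[OF iK] by simp
        qed
      qed
      then show "\<exists>no. \<forall>n\<ge>no. norm (N (f - (\<Sum>j<n. h (\<pi> j))) - 0) < \<delta>"
        using nonneg by auto
    qed
  qed
  ultimately show ?thesis by (rule that)
qed

section \<open>Blocks of Walsh characters\<close>

definition digit_sum :: "nat set \<Rightarrow> nat" where
  "digit_sum S = (\<Sum>i\<in>S. 2 ^ i)"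

lemma bit_digit_sum: "finite S \<Longrightarrow> bit (digit_sum S) j \<longleftrightarrow> j \<in> S"
  by (simp add: digit_sum_def bit_sum_powers)

lemma walsh_digit_sum: "finite S \<Longrightarrow> walsh (digit_sum S) x = (\<Prod>i\<in>S. rademacher i x)"
  by (simp add: digit_sum_def walsh_sum_powers)

text \<open>Index pair of the character obtained from \<open>walsh n\<close> in x and
  \<open>walsh k\<close> in y by multiplying with rho_i for all i in S; xor performs the
  multiplication in each coordinate.\<close>

definition frequency :: "(nat \<times> nat) \<times> nat set \<Rightarrow> nat \<times> nat" where
  "frequency = (\<lambda>((n, k), S). (xor n (digit_sum S), xor k (digit_sum S)))"

lemma walsh2_frequency:
  assumes "finite S"
  shows "walsh2 (frequency (t, S)) z
    = walsh (fst t) (fst z) * walsh (snd t) (snd z) * (\<Prod>i\<in>S. rademacher i (fst z) * rademacher i (snd z))"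
  using assms
  by (cases t) (simp add: frequency_def walsh2_def walsh_digit_sum prod.distrib flip: walsh_xor)

lemma not_bit_high: "n < 2 ^ m \<Longrightarrow> m \<le> j \<Longrightarrow> \<not> bit (n::nat) j"
proof -
  assume "n < 2 ^ m" "m \<le> j"
  then have "n < 2 ^ j" by (meson less_le_trans one_le_numeral power_increasing)
  then show ?thesis by (simp add: bit_nat_def)
qed

definition cells :: "nat \<Rightarrow> (nat \<times> nat) set" where
  "cells m = {..<2 ^ m} \<times> {..<2 ^ m}"

text \<open>Indices of the characters in the expansion of the indicator of a cell times
  \<open>1 - digit_prod I\<close>.\<close>

definition unit_terms :: "nat \<Rightarrow> nat set \<Rightarrow> ((nat \<times> nat) \<times> nat set) set" where
  "unit_terms m I = cells m \<times> (Pow I - {{}})"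

lemma finite_cells [simp]: "finite (cells m)"
  by (simp add: cells_def)

lemma card_cells: "card (cells m) = 4 ^ m"
  by (simp add: cells_def card_cartesian_product flip: power_mult_distrib)

lemma finite_unit_terms: "finite I \<Longrightarrow> finite (unit_terms m I)"
  by (simp add: unit_terms_def)

lemma card_unit_terms: "finite I \<Longrightarrow> card (unit_terms m I) \<le> 4 ^ m * 2 ^ card I"
  by (simp add: unit_terms_def card_cartesian_product card_cells card_Diff_singleton card_Pow)

definition cell :: "nat \<Rightarrow> real \<times> real \<Rightarrow> nat \<times> nat" where
  "cell m z = (dyadic_index m (fst z), dyadic_index m (snd z))"

lemma cell_in_cells [simp]: "cell m z \<in> cells m"
  by (simp add: cell_def cells_def dyadic_index_less)

text \<open>A Riesz product in the functions rho_i. All factors are 0 or 2, so it is 0 except where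
  every rho_i is 1.\<close>

definition digit_prod :: "nat set \<Rightarrow> real \<times> real \<Rightarrow> real" where
  "digit_prod I z = (\<Prod>i\<in>I. 1 + rademacher i (fst z) * rademacher i (snd z))"

text \<open>The coefficient of t in the Walsh expansion of the indicator of u, taken from
  \<open>dyadic_indicator_eq\<close> in both coordinates. The sign is the one that
  \<open>digit_prod_expansion\<close> puts in front of every product.\<close>

definition unit_coeff :: "nat \<Rightarrow> nat \<times> nat \<Rightarrow> nat \<times> nat \<Rightarrow> real" where
  "unit_coeff m u t = - (walsh (fst t) (real (fst u) / 2 ^ m) / 2 ^ m * (walsh (snd t) (real (snd u) / 2 ^ m) / 2 ^ m))"

lemma abs_unit_coeff: "\<bar>unit_coeff m u t\<bar> = 1 / 4 ^ m"
  by (simp add: unit_coeff_def abs_mult flip: power_mult_distrib)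

lemma digit_prod_values:
  assumes "finite I"
  shows "digit_prod I z = 0 \<or> digit_prod I z = 2 ^ card I"
proof (cases "\<exists>i\<in>I. rademacher i (fst z) * rademacher i (snd z) = -1")
  case True
  then have "\<exists>i\<in>I. 1 + rademacher i (fst z) * rademacher i (snd z) = 0"
    by (metis add.right_inverse)
  then show ?thesis using assms by (simp add: digit_prod_def prod_zero)
next
  case False
  then have "rademacher i (fst z) * rademacher i (snd z) = 1" if "i \<in> I" for i
    using that rademacher_cases[of i "fst z"] rademacher_cases[of i "snd z"] by auto
  then show ?thesis by (simp add: digit_prod_def)
qed

text \<open>The empty set yields the 1 that cancels. Hence every remaining product contains a digit
  of I, and no character of the bare cell indicator is left after multiplication.\<close>

lemma digit_prod_expansion:
  assumes "finite I"
  shows "1 - digit_prod I z = - (\<Sum>S\<in>Pow I - {{}}. \<Prod>i\<in>S. rademacher i (fst z) * rademacher i (snd z))"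
proof -
  have "digit_prod I z = (\<Sum>S\<in>Pow I. \<Prod>i\<in>S. rademacher i (fst z) * rademacher i (snd z))"
    unfolding digit_prod_def using prod_add[OF assms, of "\<lambda>i. rademacher i (fst z) * rademacher i (snd z)" "\<lambda>_. 1"]
    by (simp add: add.commute)
  also have "\<dots> = 1 + (\<Sum>S\<in>Pow I - {{}}. \<Prod>i\<in>S. rademacher i (fst z) * rademacher i (snd z))"
    using assms by (subst sum.remove[of _ "{}"]) auto
  finally show ?thesis by simp
qed

lemma unit_expansion:
  assumes "finite I" "u \<in> cells m"
  shows "of_bool (cell m z = u) * (1 - digit_prod I z)
    = (\<Sum>x\<in>unit_terms m I. unit_coeff m u (fst x) * walsh2 (frequency x) z)"
proof -
  obtain a b where u: "u = (a, b)" "a < 2 ^ m" "b < 2 ^ m"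
    using assms(2) by (auto simp: cells_def)
  let ?P = "\<lambda>S. \<Prod>i\<in>S. rademacher i (fst z) * rademacher i (snd z)"
  let ?A = "\<lambda>n. walsh n (real a / 2 ^ m) / 2 ^ m * walsh n (fst z)"
  let ?B = "\<lambda>n. walsh n (real b / 2 ^ m) / 2 ^ m * walsh n (snd z)"
  have "of_bool (cell m z = u) = (of_bool (dyadic_index m (fst z) = a) * of_bool (dyadic_index m (snd z) = b) :: real)"
    by (auto simp: cell_def u)
  also have "\<dots> = (\<Sum>t\<in>cells m. ?A (fst t) * ?B (snd t))"
    unfolding dyadic_indicator_eq[OF u(2)] dyadic_indicator_eq[OF u(3)] sum_product
    by (simp add: cells_def sum.cartesian_product case_prod_unfold)
  finally have 1: "of_bool (cell m z = u) = (\<Sum>t\<in>cells m. ?A (fst t) * ?B (snd t))" .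
  have "of_bool (cell m z = u) * (1 - digit_prod I z)
      = - (\<Sum>t\<in>cells m. \<Sum>S\<in>Pow I - {{}}. ?A (fst t) * ?B (snd t) * ?P S)"
    unfolding 1 digit_prod_expansion[OF assms(1)] by (simp only: sum_product mult_minus_right)
  also have "\<dots> = (\<Sum>t\<in>cells m. \<Sum>S\<in>Pow I - {{}}. unit_coeff m u t * walsh2 (frequency (t, S)) z)"
    unfolding sum_negf[symmetric]
  proof (intro sum.cong refl)
    fix t S assume "S \<in> Pow I - {{}}"
    then have "finite S" using assms(1) finite_subset by auto
    then show "- (?A (fst t) * ?B (snd t) * ?P S) = unit_coeff m u t * walsh2 (frequency (t, S)) z"
      by (simp add: walsh2_frequency unit_coeff_def u)
  qed
  also have "\<dots> = (\<Sum>x\<in>unit_terms m I. unit_coeff m u (fst x) * walsh2 (frequency x) z)"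
    by (simp add: unit_terms_def sum.cartesian_product case_prod_unfold)
  finally show ?thesis .
qed

text \<open>The indices in t have no bits from position m on, so at these positions the xor shows
  the digits in S undisturbed, in both coordinates alike.\<close>

lemma bit_frequency:
  assumes "finite S" "t \<in> cells m" "m \<le> j"
  shows "bit (fst (frequency (t, S))) j \<longleftrightarrow> j \<in> S" "bit (snd (frequency (t, S))) j \<longleftrightarrow> j \<in> S"
  using assms not_bit_high[of "fst t" m j] not_bit_high[of "snd t" m j]
  by (auto simp: frequency_def cells_def bit_xor_iff bit_digit_sum)

text \<open>Any digit in the nonempty set S is such a bit. This keeps both indices positive and also
  shows which pairs can never be frequencies.\<close>

lemma frequency_common_bit:
  assumes "finite I" "I \<subseteq> {m..}" "x \<in> unit_terms m I"
  shows "\<exists>j. bit (fst (frequency x)) j \<and> bit (snd (frequency x)) j"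
proof -
  obtain t S where x: "x = (t, S)" "t \<in> cells m" "S \<subseteq> I" "S \<noteq> {}"
    using assms(3) by (auto simp: unit_terms_def)
  then obtain j where "j \<in> S" by blast
  moreover have "m \<le> j" using \<open>j \<in> S\<close> assms(2) x by auto
  moreover have "finite S" using assms(1) x finite_subset by blast
  ultimately show ?thesis using bit_frequency[of S t m j] x by auto
qed

lemma frequency_nonzero:
  assumes "finite I" "I \<subseteq> {m..}" "x \<in> unit_terms m I"
  shows "frequency x \<noteq> (0, 0)" "frequency x \<in> pos_pairs"
proof -
  from frequency_common_bit[OF assms] obtain j where
    "bit (fst (frequency x)) j" "bit (snd (frequency x)) j" by blast
  then have "fst (frequency x) \<noteq> 0" "snd (frequency x) \<noteq> 0" by (metis bit_0_eq bot_apply bot_bool_def)+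
  then show "frequency x \<noteq> (0, 0)" "frequency x \<in> pos_pairs"
    by (auto simp: mem_Times_iff)
qed

text \<open>A digit of the term of higher level m' lies above both levels, so it can be read off
  either representation of the frequency and must belong to both digit sets.\<close>

lemma frequency_eq_meet:
  assumes "finite I" "finite I'" "I \<subseteq> {m..}" "I' \<subseteq> {m'..}" "m \<le> m'"
    and "x \<in> unit_terms m I" "x' \<in> unit_terms m' I'" "frequency x = frequency x'"
  shows "I \<inter> I' \<noteq> {}"
proof -
  define t S t' S' where "t = fst x" "S = snd x" "t' = fst x'" "S' = snd x'"
  then have x: "x = (t, S)" "t \<in> cells m" "S \<subseteq> I" "x' = (t', S')" "t' \<in> cells m'" "S' \<subseteq> I'" "S' \<noteq> {}"
    using assms(6,7) by (simp_all add: unit_terms_def mem_Times_iff)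
  then obtain j where j: "j \<in> S'" by blast
  have "m' \<le> j" using j x assms(4) by auto
  moreover have "finite S" "finite S'" using assms(1,2) x finite_subset by blast+
  ultimately have "j \<in> S"
    using bit_frequency(1)[of S t m j] bit_frequency(1)[of S' t' m' j] x j assms(5,8) by simp
  then show ?thesis using j x by blast
qed

text \<open>The bits from m on determine S, and xor with the number built from S is invertible,
  which recovers the pair of low indices.\<close>

lemma inj_on_frequency:
  assumes "finite I" "I \<subseteq> {m..}"
  shows "inj_on frequency (unit_terms m I)"
proof (rule inj_onI)
  fix x x' assume *: "x \<in> unit_terms m I" "x' \<in> unit_terms m I" "frequency x = frequency x'"
  define n k S where "n = fst (fst x)" "k = snd (fst x)" "S = snd x"
  then have x: "x = ((n, k), S)" "(n, k) \<in> cells m" "S \<subseteq> I"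
    using * by (simp_all add: unit_terms_def mem_Times_iff)
  define n' k' S' where "n' = fst (fst x')" "k' = snd (fst x')" "S' = snd x'"
  then have x': "x' = ((n', k'), S')" "(n', k') \<in> cells m" "S' \<subseteq> I"
    using * by (simp_all add: unit_terms_def mem_Times_iff)
  have fin: "finite S" "finite S'" using x x' assms(1) finite_subset by blast+
  have "S = S'"
  proof (rule set_eqI)
    fix j
    show "j \<in> S \<longleftrightarrow> j \<in> S'"
    proof (cases "m \<le> j")
      case True
      then show ?thesis
        using bit_frequency(1)[of S "(n, k)" m j] bit_frequency(1)[of S' "(n', k')" m j] x x' fin *(3) by simp
    next
      case False
      then show ?thesis using x x' assms(2) by auto
    qed
  qed
  then have "xor n (digit_sum S) = xor n' (digit_sum S)" "xor k (digit_sum S) = xor k' (digit_sum S)"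
    using *(3) x x' by (auto simp: frequency_def)
  then have "n = n'" "k = k'"
    by (auto simp: bit_eq_iff bit_xor_iff)
  then show "x = x'" using x x' \<open>S = S'\<close> by simp
qed

definition enumeration :: "'a set \<Rightarrow> 'a list" where
  "enumeration X = (SOME l. set l = X \<and> distinct l)"

lemma enumeration:
  assumes "finite X"
  shows "set (enumeration X) = X" "distinct (enumeration X)"
  using someI_ex[OF finite_distinct_list[OF assms]] by (simp_all add: enumeration_def)

lemma take_concat_map:
  obtains i where "take n (concat (map f xs)) = concat (map f (take i xs))"
  | i j where "i < length xs" "take n (concat (map f xs)) = concat (map f (take i xs)) @ take j (f (xs ! i))"
proof -
  have "\<exists>i j. take n (concat (map f xs)) = concat (map f (take i xs)) \<or> i < length xs \<and>
      take n (concat (map f xs)) = concat (map f (take i xs)) @ take j (f (xs ! i))"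
  proof (induction xs arbitrary: n)
    case (Cons x xs)
    show ?case
    proof (cases "n \<le> length (f x)")
      case True
      then show ?thesis by (intro exI[of _ 0] exI[of _ n]) simp
    next
      case False
      obtain i j where "take (n - length (f x)) (concat (map f xs)) = concat (map f (take i xs)) \<or> i < length xs \<and>
        take (n - length (f x)) (concat (map f xs)) = concat (map f (take i xs)) @ take j (f (xs ! i))"
        using Cons by blast
      then show ?thesis using False
        by (intro exI[of _ "Suc i"] exI[of _ j]) auto
    qed
  qed simp
  then show ?thesis using that by blast
qed

text \<open>Level m s of the cells of block s, values v s u on the cells, and an exponent b s
  bounding them. In \<open>m_ge\<close> the factor s + 2 serves two purposes: its constant 2 makes
  an incomplete cell small in L^2, and its growing part s gives convergence for q arbitrarily close
  to 2.\<close>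

locale walsh_blocks =
  fixes m b :: "nat \<Rightarrow> nat" and v :: "nat \<Rightarrow> nat \<times> nat \<Rightarrow> real"
  assumes v_le: "\<And>s u. \<bar>v s u\<bar> \<le> 2 ^ b s"
    and m_ge: "\<And>s. (s + 2) * (s + b s + 1) \<le> m s"
begin

text \<open>Since \<open>l \<le> prod_encode (i, l)\<close>, the digits are not among the first \<open>m s\<close>, which are used for
  the cells.\<close>

definition digits :: "nat \<Rightarrow> nat \<times> nat \<Rightarrow> nat set" where
  "digits s u = (\<lambda>l. prod_encode (prod_encode (s, prod_encode u), l)) ` {m s..<m s + s}"

lemma finite_digits [simp]: "finite (digits s u)"
  by (simp add: digits_def)

lemma card_digits: "card (digits s u) = s"
  unfolding digits_def by (subst card_image) (auto simp: inj_on_def)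

lemma digits_ge: "digits s u \<subseteq> {m s..}"
  using le_prod_encode_2 by (auto simp: digits_def intro: order_trans)

lemma digits_disjoint: "digits s u \<inter> digits s' u' \<noteq> {} \<Longrightarrow> s = s' \<and> u = u'"
  by (auto simp: digits_def)

definition index :: "(nat \<times> (nat \<times> nat) \<times> (nat \<times> nat) \<times> nat set) set" where
  "index = {(s, u, x). u \<in> cells (m s) \<and> x \<in> unit_terms (m s) (digits s u)}"

definition freq :: "nat \<times> (nat \<times> nat) \<times> (nat \<times> nat) \<times> nat set \<Rightarrow> nat \<times> nat" where
  "freq = (\<lambda>(s, u, x). frequency x)"

text \<open>Equal frequencies share a digit by \<open>frequency_eq_meet\<close>, and a digit belongs
  to one cell of one block only. Within that cell \<open>inj_on_frequency\<close> decides.\<close>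

lemma inj_on_freq: "inj_on freq index"
proof (rule inj_onI)
  fix y y' assume "y \<in> index" "y' \<in> index" "freq y = freq y'"
  moreover obtain s u t S where y: "y = (s, u, t, S)" by (rule prod_cases4)
  moreover obtain s' u' t' S' where y': "y' = (s', u', t', S')" by (rule prod_cases4)
  ultimately have *: "(s, u, t, S) \<in> index" "(s', u', t', S') \<in> index" "freq (s, u, t, S) = freq (s', u', t', S')"
    by simp_all
  have "digits s u \<inter> digits s' u' \<noteq> {}"
  proof (cases "m s \<le> m s'")
    case True
    then show ?thesis
      using * digits_ge by (intro frequency_eq_meet[of _ _ "m s" "m s'" "(t, S)" "(t', S')"]) (auto simp: index_def freq_def)
  next
    case False
    then have "digits s' u' \<inter> digits s u \<noteq> {}"
      using * digits_ge by (intro frequency_eq_meet[of _ _ "m s'" "m s" "(t', S')" "(t, S)"]) (auto simp: index_def freq_def)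
    then show ?thesis by blast
  qed
  then have "s = s'" "u = u'" using digits_disjoint by blast+
  moreover have "(t, S) = (t', S')"
    using * inj_on_frequency[OF finite_digits digits_ge, of s u] \<open>s = s'\<close> \<open>u = u'\<close>
    by (auto simp: inj_on_def index_def freq_def)
  ultimately show "y = y'" using y y' by simp
qed

definition spectrum :: "(nat \<times> nat) set" where
  "spectrum = freq ` index"

text \<open>By \<open>inj_on_freq\<close> each character is claimed by one cell of one block, so the
  inverse of \<open>freq\<close> recovers its coefficient. The value 0 elsewhere lets the remaining
  characters be placed anywhere.\<close>

definition coeff :: "nat \<times> nat \<Rightarrow> real" where
  "coeff p = (if p \<in> spectrum
     then case inv_into index freq p of (s, u, t, S) \<Rightarrow> v s u * unit_coeff (m s) u t else 0)"

lemma coeff_freq: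
  "(s, u, t, S) \<in> index \<Longrightarrow> coeff (freq (s, u, t, S)) = v s u * unit_coeff (m s) u t"
  by (simp add: coeff_def spectrum_def inv_into_f_f[OF inj_on_freq])

definition unit_spectrum :: "nat \<Rightarrow> nat \<times> nat \<Rightarrow> (nat \<times> nat) set" where
  "unit_spectrum s u = frequency ` unit_terms (m s) (digits s u)"

lemma finite_unit_spectrum [simp]: "finite (unit_spectrum s u)"
  by (simp add: unit_spectrum_def finite_unit_terms)

lemma unit_spectrum_eq: "unit_spectrum s u = (\<lambda>x. freq (s, u, x)) ` unit_terms (m s) (digits s u)"
  by (auto simp: unit_spectrum_def freq_def)

lemma spectrum_eq: "spectrum = (\<Union>s. \<Union>u\<in>cells (m s). unit_spectrum s u)"
  by (fastforce simp: spectrum_def unit_spectrum_eq index_def)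

lemma unit_spectrum_disjoint:
  assumes "u \<in> cells (m s)" "u' \<in> cells (m s')" "(s, u) \<noteq> (s', u')"
  shows "unit_spectrum s u \<inter> unit_spectrum s' u' = {}"
proof (rule ccontr)
  assume "\<not> ?thesis"
  then obtain p where p: "p \<in> unit_spectrum s u" "p \<in> unit_spectrum s' u'" by blast
  obtain x where x: "x \<in> unit_terms (m s) (digits s u)" "p = freq (s, u, x)"
    using p(1) unfolding unit_spectrum_eq by blast
  obtain x' where x': "x' \<in> unit_terms (m s') (digits s' u')" "p = freq (s', u', x')"
    using p(2) unfolding unit_spectrum_eq by blast
  have "(s, u, x) = (s', u', x')"
    using assms x x' by (intro inj_onD[OF inj_on_freq]) (auto simp: index_def)
  then show False using assms(3) by simp
qed

lemma spectrum_pos: "spectrum \<subseteq> pos_pairs"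
  unfolding spectrum_eq unit_spectrum_def
  using frequency_nonzero(2)[OF finite_digits digits_ge] by blast

text \<open>Two different powers of 2 have no common bit, while every frequency in the spectrum
  does. Infinitely many vanishing terms are required to fill the places off the diagonal.\<close>

lemma infinite_spectrum_complement: "infinite (pos_pairs - spectrum)"
proof -
  have "(2 ^ i, 2 ^ Suc i) \<notin> spectrum" for i
  proof
    assume "(2 ^ i, 2 ^ Suc i) \<in> spectrum"
    then obtain s u x where x: "x \<in> unit_terms (m s) (digits s u)" "(2 ^ i, 2 ^ Suc i) = frequency x"
      unfolding spectrum_eq unit_spectrum_def by blast
    from frequency_common_bit[OF finite_digits digits_ge x(1)]
    obtain j where "bit (fst (2 ^ i :: nat, 2 ^ Suc i :: nat)) j" "bit (snd (2 ^ i :: nat, 2 ^ Suc i :: nat)) j"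
      unfolding x(2) by blast
    then have "j = i" "j = Suc i" unfolding fst_conv snd_conv bit_exp_iff by simp_all
    then show False by simp
  qed
  then have "(\<lambda>i. (2 ^ i, 2 ^ Suc i)) ` UNIV \<subseteq> pos_pairs - spectrum"
    by auto
  moreover have "infinite (range (\<lambda>i. (2 ^ i, 2 ^ Suc i) :: nat \<times> nat))"
    by (rule range_inj_infinite) (auto simp: inj_on_def)
  ultimately show ?thesis using finite_subset by blast
qed

section \<open>Blocks as ordered lists, and their exceptional sets\<close>

definition block :: "nat \<Rightarrow> (nat \<times> nat) list" where
  "block s = concat (map (\<lambda>u. enumeration (unit_spectrum s u)) (enumeration (cells (m s))))"

lemma set_block: "set (block s) = (\<Union>u\<in>cells (m s). unit_spectrum s u)"
  by (simp add: block_def enumeration)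

lemma block_subset: "set (block s) \<subseteq> spectrum"
  by (auto simp: set_block spectrum_eq)

lemma spectrum_blocks: "spectrum = (\<Union>s. set (block s))"
  by (simp add: set_block spectrum_eq)

lemma block_disjoint: "s \<noteq> s' \<Longrightarrow> set (block s) \<inter> set (block s') = {}"
  using unit_spectrum_disjoint[of _ s _ s'] unfolding set_block by blast

lemma distinct_concat_units:
  assumes "distinct us" "set us \<subseteq> cells (m s)"
  shows "distinct (concat (map (\<lambda>u. enumeration (unit_spectrum s u)) us))"
  using assms
proof (induction us)
  case (Cons u us)
  have "unit_spectrum s u \<inter> unit_spectrum s u' = {}" if "u' \<in> set us" for u'
    using Cons that by (intro unit_spectrum_disjoint) auto
  then show ?case using Cons by (auto simp: enumeration)
qed simp

lemma distinct_block: "distinct (block s)"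
  unfolding block_def by (intro distinct_concat_units) (simp_all add: enumeration)

lemma abs_coeff:
  assumes "u \<in> cells (m s)" "p \<in> unit_spectrum s u"
  shows "\<bar>coeff p\<bar> \<le> 2 ^ b s / 4 ^ m s"
proof -
  obtain t S where "p = freq (s, u, t, S)" "(s, u, t, S) \<in> index"
    using assms by (auto simp: unit_spectrum_eq index_def)
  then have "\<bar>coeff p\<bar> = \<bar>v s u\<bar> * (1 / 4 ^ m s)"
    by (simp add: coeff_freq abs_mult abs_unit_coeff)
  then show ?thesis using v_le[of s u] by (simp add: divide_right_mono)
qed

lemma card_unit_spectrum: "card (unit_spectrum s u) \<le> 4 ^ m s * 2 ^ s"
  using card_image_le[OF finite_unit_terms[OF finite_digits], of frequency "m s" s u]
    card_unit_terms[OF finite_digits, of "m s" s u]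
  by (simp add: unit_spectrum_def card_digits)

definition summand :: "nat \<times> nat \<Rightarrow> real \<times> real \<Rightarrow> real" where
  "summand p z = coeff p * walsh2 p z"

text \<open>The Riesz product of the cell containing z. It is 2^s rather than 1 on the exceptional
  set, so that 1 - \<open>bad s\<close> is the factor between the sum of the block and its step
  function.\<close>

definition bad :: "nat \<Rightarrow> real \<times> real \<Rightarrow> real" where
  "bad s z = digit_prod (digits s (cell (m s) z)) z"

lemma sum_unit:
  assumes "u \<in> cells (m s)"
  shows "(\<Sum>p\<in>unit_spectrum s u. summand p z) = (if cell (m s) z = u then v s u * (1 - bad s z) else 0)"
proof -
  have "(\<Sum>p\<in>unit_spectrum s u. summand p z)
      = (\<Sum>x\<in>unit_terms (m s) (digits s u). summand (frequency x) z)"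
    unfolding unit_spectrum_def
    by (subst sum.reindex) (simp_all add: inj_on_frequency[OF finite_digits digits_ge])
  also have "\<dots> = (\<Sum>x\<in>unit_terms (m s) (digits s u). v s u * (unit_coeff (m s) u (fst x) * walsh2 (frequency x) z))"
  proof (intro sum.cong refl)
    fix x assume "x \<in> unit_terms (m s) (digits s u)"
    then show "summand (frequency x) z = v s u * (unit_coeff (m s) u (fst x) * walsh2 (frequency x) z)"
      using coeff_freq[of s u "fst x" "snd x"] assms by (simp add: summand_def index_def freq_def)
  qed
  also have "\<dots> = v s u * (of_bool (cell (m s) z = u) * (1 - digit_prod (digits s u) z))"
    unfolding unit_expansion[OF finite_digits assms] by (simp add: sum_distrib_left)
  finally show ?thesis by (auto simp: bad_def)
qed

lemma sum_list_units:
  assumes "distinct us" "set us \<subseteq> cells (m s)"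
  shows "(\<Sum>p\<leftarrow>concat (map (\<lambda>u. enumeration (unit_spectrum s u)) us). summand p z)
    = (if cell (m s) z \<in> set us then v s (cell (m s) z) * (1 - bad s z) else 0)"
  using assms
proof (induction us)
  case (Cons u us)
  have "(\<Sum>p\<leftarrow>enumeration (unit_spectrum s u). summand p z) = (\<Sum>p\<in>unit_spectrum s u. summand p z)"
    by (simp add: sum_list_distinct_conv_sum_set enumeration)
  then show ?case using Cons by (auto simp: sum_unit)
qed simp

lemma sum_block: "(\<Sum>p\<leftarrow>block s. summand p z) = v s (cell (m s) z) * (1 - bad s z)"
  unfolding block_def by (subst sum_list_units) (simp_all add: enumeration)

lemma bad_values: "bad s z = 0 \<or> bad s z = 2 ^ s"
  unfolding bad_def using digit_prod_values[OF finite_digits] by (simp add: card_digits)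

lemma bad_expansion:
  "1 - bad s z = (\<Sum>u\<in>cells (m s). \<Sum>x\<in>unit_terms (m s) (digits s u).
      unit_coeff (m s) u (fst x) * walsh2 (frequency x) z)"
proof -
  have "1 - bad s z = (\<Sum>u\<in>cells (m s). if u = cell (m s) z then 1 - digit_prod (digits s u) z else 0)"
    by (simp add: bad_def)
  also have "\<dots> = (\<Sum>u\<in>cells (m s). of_bool (cell (m s) z = u) * (1 - digit_prod (digits s u) z))"
    by (intro sum.cong) auto
  finally show ?thesis by (simp add: unit_expansion)
qed

lemma borel_measurable_bad [measurable]: "bad s \<in> borel_measurable borel"
proof -
  have "bad s z = 1 - (\<Sum>u\<in>cells (m s). \<Sum>x\<in>unit_terms (m s) (digits s u).
      unit_coeff (m s) u (fst x) * walsh2 (frequency x) z)" for z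
    using bad_expansion[of s z] by simp
  then show ?thesis by (subst ext[of "bad s"]) measurable
qed

text \<open>Every character in the expansion of 1 - \<open>bad s\<close> carries a digit, so it is
  nonconstant and integrates to 0.\<close>

lemma integral_bad: "(LINT z|square_measure. bad s z) = 1"
proof -
  have "(LINT z|square_measure. 1 - (\<Sum>u\<in>cells (m s). \<Sum>x\<in>unit_terms (m s) (digits s u).
      unit_coeff (m s) u (fst x) * walsh2 (frequency x) z)) = 1 - (\<Sum>u\<in>cells (m s).
      \<Sum>x\<in>unit_terms (m s) (digits s u). unit_coeff (m s) u (fst x) * integral\<^sup>L square_measure (walsh2 (frequency x)))"
    by (simp add: Bochner_Integration.integral_diff Bochner_Integration.integral_sum)
  also have "\<dots> = 1"
    using frequency_nonzero(1)[OF finite_digits digits_ge]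
    by (simp add: integral_walsh2)
  finally show ?thesis by (simp flip: bad_expansion)
qed

definition bad_set :: "nat \<Rightarrow> (real \<times> real) set" where
  "bad_set s = {z \<in> unit_square. bad s z \<noteq> 0}"

lemma bad_set_sets: "bad_set s \<in> sets square_measure"
proof -
  have [measurable]: "bad s \<in> borel_measurable square_measure"
    by (intro borel_imp_square_measurable borel_measurable_bad)
  have "{z \<in> space square_measure. bad s z \<noteq> 0} \<in> sets square_measure" by measurable
  then show ?thesis by (simp add: bad_set_def)
qed

text \<open>\<open>bad s\<close> has mean 1 and takes only the values 0 and 2^s.\<close>

lemma measure_bad_set: "measure square_measure (bad_set s) = (1/2) ^ s"
proof -
  have "(LINT z|square_measure. bad s z) = (LINT z|square_measure. 2 ^ s * indicator (bad_set s) z)"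
    using bad_values by (intro Bochner_Integration.integral_cong) (auto simp: bad_set_def indicator_def)
  also have "\<dots> = 2 ^ s * measure square_measure (bad_set s)"
    by (simp only: integral_mult_right_zero Bochner_Integration.integral_indicator
        sets.Int_space_eq2[OF bad_set_sets])
  finally show ?thesis unfolding integral_bad by (simp add: field_simps)
qed

text \<open>A prefix of a block consists of complete units, which sum up to the step function off the
  bad set, and part of one more unit, whose square norm is small since its coefficients are.\<close>

lemma block_prefix:
  obtains U F where "F \<subseteq> spectrum" "finite F"
    "\<And>z. (\<Sum>p\<leftarrow>take n (block s). summand p z)
      = (if cell (m s) z \<in> U then v s (cell (m s) z) * (1 - bad s z) else 0) + (\<Sum>p\<in>F. summand p z)"
    "(LINT z|square_measure. \<bar>\<Sum>p\<in>F. summand p z\<bar>) \<le> (1/2) ^ Suc s"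
proof -
  let ?us = "enumeration (cells (m s))"
  let ?e = "\<lambda>u. enumeration (unit_spectrum s u)"
  have us: "distinct (take i ?us)" "set (take i ?us) \<subseteq> cells (m s)" for i
    using set_take_subset[of i ?us] by (simp_all add: enumeration)
  from take_concat_map[of n ?e ?us] show ?thesis
  proof cases
    case (1 i)
    show ?thesis
      by (rule that[of "{}" "set (take i ?us)"]) (use us[of i] 1 in \<open>simp_all add: block_def sum_list_units\<close>)
  next
    case (2 i j)
    define u where "u = ?us ! i"
    have u: "u \<in> cells (m s)" unfolding u_def using 2(1) nth_mem[of i ?us] by (simp add: enumeration)
    define F where "F = set (take j (?e u))"
    have F: "F \<subseteq> unit_spectrum s u"
      unfolding F_def using set_take_subset[of j "?e u"] by (simp add: enumeration)
    have fin: "finite F" by (simp add: F_def)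
    have "(\<Sum>p\<leftarrow>take j (?e u). summand p z) = (\<Sum>p\<in>F. summand p z)" for z
      unfolding F_def by (intro sum_list_distinct_conv_sum_set) (simp add: enumeration)
    then have split: "(\<Sum>p\<leftarrow>take n (block s). summand p z)
      = (if cell (m s) z \<in> set (take i ?us) then v s (cell (m s) z) * (1 - bad s z) else 0) + (\<Sum>p\<in>F. summand p z)" for z
      unfolding block_def 2(2) by (simp add: sum_list_units[OF us] flip: u_def)
    \<comment> \<open>A single cell has about 4^m characters with squared coefficients of order
      16^(-m), up to powers of 2 in s and b; this is why the incomplete cell is negligible while the
      whole block is not.\<close>
    have "(\<Sum>p\<in>F. (coeff p)\<^sup>2) \<le> (\<Sum>p\<in>unit_spectrum s u. (2 ^ b s / 4 ^ m s)\<^sup>2)"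
    proof (rule order_trans[OF sum_mono2[OF finite_unit_spectrum F] sum_mono])
      fix p assume "p \<in> unit_spectrum s u"
      then show "(coeff p)\<^sup>2 \<le> (2 ^ b s / 4 ^ m s)\<^sup>2"
        using abs_coeff[OF u] by (metis abs_ge_zero power2_abs power_mono)
    qed simp
    also have "\<dots> \<le> (4 ^ m s * 2 ^ s) * (2 ^ b s / 4 ^ m s)\<^sup>2"
    proof -
      have "real (card (unit_spectrum s u)) \<le> real (4 ^ m s * 2 ^ s)"
        using card_unit_spectrum by (intro of_nat_mono)
      then show ?thesis by (simp add: mult_right_mono)
    qed
    also have "\<dots> = 2 ^ (s + 2 * b s) / 2 ^ (2 * m s)"
      by (simp add: power2_eq_square power_add power_mult field_simps flip: power_mult_distrib)
    also have "\<dots> \<le> ((1/2) ^ Suc s)\<^sup>2"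
    proof -
      have "2 * (s + b s + 1) \<le> m s" by (rule order_trans[OF mult_le_mono1 m_ge]) simp
      then have "s + 2 * b s + 2 * Suc s \<le> 2 * m s" by simp
      then have "(2::real) ^ (s + 2 * b s + 2 * Suc s) \<le> 2 ^ (2 * m s)" by (intro power_increasing) auto
      then have "2 ^ (s + 2 * b s) * (2::real) ^ (2 * Suc s) \<le> 2 ^ (2 * m s)" by (simp only: power_add)
      moreover have "((1/2) ^ Suc s)\<^sup>2 = 1 / (2::real) ^ (2 * Suc s)"
        by (simp add: power_divide power_mult power2_eq_square flip: power_mult_distrib)
      ultimately show ?thesis by (simp add: field_simps del: power_Suc)
    qed
    finally have "(LINT z|square_measure. \<bar>\<Sum>p\<in>F. coeff p * walsh2 p z\<bar>) \<le> (1/2) ^ Suc s"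
      by (intro integral_abs_walsh2_sum_le fin) auto
    then show ?thesis
      using F u fin split by (intro that[of F "set (take i ?us)"]) (auto simp: summand_def spectrum_eq)
  qed
qed

text \<open>Counting terms bounds the contribution of block s by 2 to the power 4m + s + (b - 2m) q
  = s + b q - 2 (q - 2) m. Once (q - 2) m is at least q (s + b + 1), this exponent is at most
  -s.\<close>

lemma summable_coeff:
  assumes "q > 2"
  shows "(\<lambda>p. \<bar>coeff p\<bar> powr q) summable_on pos_pairs"
proof -
  \<comment> \<open>For s from here on q \<le> s (q - 2). The threshold grows without bound as q
    approaches 2, so a constant factor in \<open>m_ge\<close> would not suffice for all q.\<close>
  obtain s1 :: nat where s1: "q / (q - 2) \<le> real s1" using real_arch_simple by blast
  define X where "X s = (\<Sum>p\<in>set (block s). \<bar>coeff p\<bar> powr q)" for s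
  have X_le: "X s \<le> (1/2) ^ s" if "s \<ge> s1" for s
  proof -
    have "\<forall>u\<in>cells (m s). \<forall>u'\<in>cells (m s). u \<noteq> u' \<longrightarrow> unit_spectrum s u \<inter> unit_spectrum s u' = {}"
      using unit_spectrum_disjoint by blast
    then have "X s = (\<Sum>u\<in>cells (m s). \<Sum>p\<in>unit_spectrum s u. \<bar>coeff p\<bar> powr q)"
      by (simp add: X_def set_block sum.UNION_disjoint)
    also have "\<dots> \<le> (\<Sum>u\<in>cells (m s). \<Sum>p\<in>unit_spectrum s u. (2 ^ b s / 4 ^ m s) powr q)"
      using abs_coeff assms by (intro sum_mono powr_mono2) auto
    also have "\<dots> \<le> (\<Sum>u\<in>cells (m s). (4 ^ m s * 2 ^ s) * (2 ^ b s / 4 ^ m s) powr q)"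
    proof (intro sum_mono)
      fix u
      have "real (card (unit_spectrum s u)) \<le> real (4 ^ m s * 2 ^ s)"
        using card_unit_spectrum by (intro of_nat_mono)
      then show "(\<Sum>p\<in>unit_spectrum s u. (2 ^ b s / 4 ^ m s) powr q) \<le> (4 ^ m s * 2 ^ s) * (2 ^ b s / 4 ^ m s :: real) powr q"
        by (simp add: mult_right_mono)
    qed
    also have "\<dots> = 4 ^ m s * (4 ^ m s * 2 ^ s) * (2 ^ b s / 4 ^ m s) powr q"
      by (simp add: card_cells)
    also have "\<dots> = 2 powr (2 * real (m s) + (2 * real (m s) + real s) + (real (b s) - 2 * real (m s)) * q)"
    proof -
      have 4: "(4::real) ^ k = 2 powr (2 * real k)" for k
        by (metis four_x_squared numeral_power_eq_of_nat_cancel_iff of_nat_mult of_nat_numeral power_mult powr_realpow zero_less_numeral power2_eq_square num_double numeral_times_numeral)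
      have "2 ^ b s / 4 ^ m s = (2::real) powr (real (b s) - 2 * real (m s))"
        by (simp add: 4 powr_diff powr_realpow)
      then have 1: "(2 ^ b s / 4 ^ m s) powr q = (2::real) powr ((real (b s) - 2 * real (m s)) * q)"
        by (simp add: powr_powr)
      have "4 ^ m s * (4 ^ m s * 2 ^ s) = (2::real) powr (2 * real (m s) + (2 * real (m s) + real s))"
        by (simp only: 4 powr_add) (simp add: powr_realpow)
      then show ?thesis unfolding 1 by (simp only: powr_add)
    qed
    also have "\<dots> \<le> 2 powr (- real s)"
    proof (rule powr_mono)
      have "q \<le> real s * (q - 2)"
      proof -
        have "q \<le> real s1 * (q - 2)" using s1 assms by (simp add: pos_divide_le_eq)
        also have "\<dots> \<le> real s * (q - 2)" using that assms by (intro mult_right_mono) auto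
        finally show ?thesis .
      qed
      then have "q * (real s + real (b s) + 1) \<le> real s * (q - 2) * (real s + real (b s) + 1)"
        by (intro mult_right_mono) auto
      also have "\<dots> \<le> (q - 2) * real (m s)"
      proof -
        have "real s * (real s + real (b s) + 1) \<le> real ((s + 2) * (s + b s + 1))"
          by (simp add: algebra_simps)
        also have "\<dots> \<le> real (m s)" using m_ge[of s] by (intro of_nat_mono)
        finally have "(q - 2) * (real s * (real s + real (b s) + 1)) \<le> (q - 2) * real (m s)"
          using assms by (intro mult_left_mono) auto
        then show ?thesis by (simp add: mult_ac)
      qed
      finally have 1: "q * real s + q * real (b s) + q \<le> (q - 2) * real (m s)"
        by (simp add: algebra_simps)
      have 2: "2 * real s \<le> q * real s" "0 \<le> q * real (b s)" "0 \<le> real s"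
        using assms by (auto intro: mult_right_mono)
      show "2 * real (m s) + (2 * real (m s) + real s) + (real (b s) - 2 * real (m s)) * q \<le> - real s"
      proof -
        have "(real (b s) - 2 * real (m s)) * q = q * real (b s) - 2 * (q * real (m s))"
          "(q - 2) * real (m s) = q * real (m s) - 2 * real (m s)"
          by (simp_all add: algebra_simps)
        then show ?thesis using 1 2 assms by linarith
      qed
    qed simp
    also have "\<dots> = (1/2) ^ s" by (simp add: powr_minus powr_realpow power_divide inverse_eq_divide)
    finally show ?thesis .
  qed
  have X_nonneg: "0 \<le> X s" for s unfolding X_def by (intro sum_nonneg) auto
  have X_summable: "summable X"
    by (rule summable_comparison_test'[of "\<lambda>s. (1/2) ^ s" s1]) (use X_le X_nonneg in \<open>auto simp: summable_geometric\<close>)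
  have "(\<lambda>p. \<bar>coeff p\<bar> powr q) summable_on spectrum"
  proof (rule nonneg_bdd_above_summable_on)
    show "bdd_above (sum (\<lambda>p. \<bar>coeff p\<bar> powr q) ` {F. F \<subseteq> spectrum \<and> finite F})"
    proof (rule bdd_aboveI2)
      fix F assume "F \<in> {F. F \<subseteq> spectrum \<and> finite F}"
      then have F: "F \<subseteq> (\<Union>s. set (block s))" "finite F" by (auto simp: spectrum_blocks)
      then have "\<forall>p\<in>F. \<exists>s. p \<in> set (block s)" by blast
      then obtain k where k: "\<And>p. p \<in> F \<Longrightarrow> p \<in> set (block (k p))" by metis
      have "\<exists>n. \<forall>s \<in> k ` F. s < n"
        using F(2) by (intro iffD1[OF finite_nat_set_iff_bounded]) simp
      then obtain n where n: "\<And>p. p \<in> F \<Longrightarrow> k p < n"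
        by blast
      have "(\<Sum>p\<in>F. \<bar>coeff p\<bar> powr q) \<le> (\<Sum>p\<in>(\<Union>s<n. set (block s)). \<bar>coeff p\<bar> powr q)"
      proof (rule sum_mono2)
        show "F \<subseteq> (\<Union>s<n. set (block s))" using k n by blast
      qed auto
      also have "\<dots> = (\<Sum>s<n. X s)"
        using block_disjoint by (simp add: X_def sum.UNION_disjoint)
      also have "\<dots> \<le> suminf X"
        using X_summable X_nonneg by (intro sum_le_suminf) auto
      finally show "(\<Sum>p\<in>F. \<bar>coeff p\<bar> powr q) \<le> suminf X" .
    qed
  qed simp
  then show ?thesis
    using spectrum_pos assms by (subst summable_on_cong_neutral[of spectrum _ _ "\<lambda>p. \<bar>coeff p\<bar> powr q"]) (auto simp: coeff_def)
qed

end

section \<open>The weight\<close>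

text \<open>Multiplying the prescribed bounds of all sets that contain z satisfies each of them,
  since every other factor is at most 1. By Borel-Cantelli almost every z lies in finitely many of
  the sets, so the product is finite and positive there.\<close>

lemma weight_exists:
  fixes B :: "nat \<Rightarrow> (real \<times> real) set" and \<tau> :: "nat \<Rightarrow> real"
  assumes B [measurable]: "\<And>s. B s \<in> sets square_measure"
    and B_le: "\<And>s. measure square_measure (B s) \<le> (1/2) ^ s"
    and \<tau>: "\<And>s. 0 < \<tau> s" "\<And>s. \<tau> s \<le> 1" and "0 < \<epsilon>"
  obtains \<mu> s0 where "weight \<mu>" "measure lebesgue {z \<in> unit_square. \<mu> z \<noteq> 1} < \<epsilon>"
    "\<And>s. s \<ge> s0 \<Longrightarrow> AE z in square_measure. z \<in> B s \<longrightarrow> \<mu> z \<le> \<tau> s"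
proof -
  \<comment> \<open>The sets with index at least s0 have total measure at most 2 * (1/2)^s0.\<close>
  obtain s0 :: nat where s0: "(1/2) ^ s0 < \<epsilon> / 2"
    using real_arch_pow_inv[of "\<epsilon> / 2" "1/2"] \<open>0 < \<epsilon>\<close> by auto
  define J where "J z = {s. s0 \<le> s \<and> z \<in> B s}" for z
  \<comment> \<open>\<open>J z\<close> is infinite only on a null set; the product is \<open>1\<close> there.\<close>
  define \<mu> where "\<mu> z = (\<Prod>s\<in>J z. \<tau> s)" for z
  have finite_J: "finite (J z) \<longleftrightarrow> (\<exists>n. \<forall>s. n \<le> s \<longrightarrow> s0 \<le> s \<longrightarrow> z \<notin> B s)" for z
  proof
    assume "finite (J z)"
    then have "\<exists>n. \<forall>s\<in>J z. s < n" by (rule iffD1[OF finite_nat_set_iff_bounded])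
    then show "\<exists>n. \<forall>s. n \<le> s \<longrightarrow> s0 \<le> s \<longrightarrow> z \<notin> B s"
      unfolding J_def by (metis (mono_tags, lifting) mem_Collect_eq not_less)
  next
    assume "\<exists>n. \<forall>s. n \<le> s \<longrightarrow> s0 \<le> s \<longrightarrow> z \<notin> B s"
    then obtain n where "\<forall>s. n \<le> s \<longrightarrow> s0 \<le> s \<longrightarrow> z \<notin> B s" by blast
    then have "J z \<subseteq> {..<n}" by (force simp: J_def not_less[symmetric])
    then show "finite (J z)" by (rule finite_subset) simp
  qed
  have [measurable]: "Measurable.pred square_measure (\<lambda>z. finite (J z))"
    unfolding finite_J by measurable
  have "AE z in square_measure. eventually (\<lambda>s. z \<in> space square_measure - B s) sequentially"
  proof (rule borel_cantelli_AE1)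
    show "summable (\<lambda>s. measure square_measure (B s))"
      by (rule summable_comparison_test'[of "\<lambda>s. (1/2) ^ s"]) (use B_le in \<open>auto simp: summable_geometric\<close>)
    show "emeasure square_measure (B s) < \<infinity>" for s
      by (metis sq.emeasure_finite infinity_ennreal_def less_top)
  qed simp
  then have AE_finite: "AE z in square_measure. finite (J z)"
  proof eventually_elim
    case (elim z)
    then show ?case unfolding finite_J eventually_sequentially by (metis DiffE)
  qed
  have \<mu>_meas: "\<mu> \<in> borel_measurable square_measure"
  proof (rule borel_measurable_LIMSEQ_real)
    \<comment> \<open>Where \<open>J z\<close> is finite these products are eventually constant; the
      case distinction keeps the limit equal to \<open>\<mu>\<close> on the exceptional null set as
      well.\<close>
    show "(\<lambda>z. if finite (J z) then \<Prod>s\<in>{s0..<n}. if z \<in> B s then \<tau> s else 1 else 1)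
        \<in> borel_measurable square_measure" for n
      by measurable
    fix z
    show "(\<lambda>n. if finite (J z) then \<Prod>s\<in>{s0..<n}. if z \<in> B s then \<tau> s else 1 else 1) \<longlonglongrightarrow> \<mu> z"
    proof (cases "finite (J z)")
      case True
      then have "\<exists>k. \<forall>s\<in>J z. s < k" by (rule iffD1[OF finite_nat_set_iff_bounded])
      then obtain k where k: "\<forall>s\<in>J z. s < k" by blast
      have "(\<Prod>s\<in>{s0..<n}. if z \<in> B s then \<tau> s else 1) = \<mu> z" if "n \<ge> k" for n
      proof -
        have "\<mu> z = (\<Prod>s\<in>J z. if z \<in> B s then \<tau> s else 1)"
          unfolding \<mu>_def by (intro prod.cong) (auto simp: J_def)
        also have "\<dots> = (\<Prod>s\<in>{s0..<n}. if z \<in> B s then \<tau> s else 1)"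
          using k that by (intro prod.mono_neutral_left) (auto simp: J_def)
        finally show ?thesis by simp
      qed
      then show ?thesis
        using True by (intro tendsto_eventually) (auto simp: eventually_sequentially)
    next
      case False
      then show ?thesis by (simp add: \<mu>_def)
    qed
  qed
  show ?thesis
  proof (rule that)
    show "weight \<mu>"
      using \<mu>_meas \<tau> by (auto simp: weight_def \<mu>_def less_imp_le intro: prod_pos prod_le_1)
    have sub: "{z \<in> unit_square. \<mu> z \<noteq> 1} \<subseteq> (\<Union>s. B (s + s0))"
    proof
      fix z assume "z \<in> {z \<in> unit_square. \<mu> z \<noteq> 1}"
      then have "J z \<noteq> {}" by (auto simp: \<mu>_def)
      then obtain s where "s0 \<le> s" "z \<in> B s" by (auto simp: J_def)
      then have "z \<in> B ((s - s0) + s0)" by simp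
      then show "z \<in> (\<Union>s. B (s + s0))" by blast
    qed
    have sum: "(\<lambda>s. (1/2) ^ (s + s0) :: real) sums (2 * (1/2) ^ s0)"
      using sums_mult2[OF geometric_sums[of "1/2 :: real"], of "(1/2) ^ s0"] by (simp add: power_add)
    have summable: "summable (\<lambda>s. measure square_measure (B (s + s0)))"
      by (rule summable_comparison_test'[OF sums_summable[OF sum]]) (use B_le in auto)
    have "measure lebesgue {z \<in> unit_square. \<mu> z \<noteq> 1} = measure square_measure {z \<in> unit_square. \<mu> z \<noteq> 1}"
      by (subst measure_restrict_space) auto
    also have "\<dots> \<le> measure square_measure (\<Union>s. B (s + s0))"
      using sub by (intro sq.finite_measure_mono) auto
    also have "\<dots> \<le> (\<Sum>s. measure square_measure (B (s + s0)))"
      using summable by (intro sq.finite_measure_subadditive_countably) auto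
    also have "\<dots> \<le> (\<Sum>s. (1/2) ^ (s + s0))"
      using B_le summable sums_summable[OF sum] by (intro suminf_le) auto
    also have "\<dots> < \<epsilon>" using s0 sums_unique[OF sum] by simp
    finally show "measure lebesgue {z \<in> unit_square. \<mu> z \<noteq> 1} < \<epsilon>" .
    fix s assume s: "s0 \<le> s"
    from AE_finite show "AE z in square_measure. z \<in> B s \<longrightarrow> \<mu> z \<le> \<tau> s"
    proof eventually_elim
      case (elim z)
      show ?case
      proof
        assume "z \<in> B s"
        then have "s \<in> J z" using s by (simp add: J_def)
        then have "\<mu> z = \<tau> s * (\<Prod>s\<in>J z - {s}. \<tau> s)"
          unfolding \<mu>_def using elim by (rule prod.remove[rotated])
        also have "\<dots> \<le> \<tau> s * 1"
          using \<tau> by (intro mult_left_mono prod_le_1) (auto simp: less_imp_le)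
        finally show "\<mu> z \<le> \<tau> s" by simp
      qed
    qed
  qed
qed

section \<open>Universality\<close>

lemma sum_list_fun_apply: "sum_list (map h l) z = (\<Sum>p\<leftarrow>l. h p z)" for h :: "'i \<Rightarrow> 'a \<Rightarrow> 'b::comm_monoid_add"
  by (induction l) simp_all

lemma sum_fun_apply: "(\<Sum>p\<in>F. h p) z = (\<Sum>p\<in>F. h p z)" for h :: "'i \<Rightarrow> 'a \<Rightarrow> 'b::comm_monoid_add"
  by (induction F rule: infinite_finite_induct) simp_all

context walsh_blocks
begin

definition step :: "nat \<Rightarrow> real \<times> real \<Rightarrow> real" where
  "step s z = v s (cell (m s) z)"

lemma abs_step_le: "\<bar>step s z\<bar> \<le> 2 ^ b s"
  by (simp add: step_def v_le)

lemma measurable_step [measurable]: "step s \<in> borel_measurable square_measure"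
  unfolding step_def[abs_def] cell_def
  by (intro borel_imp_square_measurable measurable_dyadic_cells[where G = "\<lambda>a c z. v s (a, c)"]) simp

lemma measurable_bad [measurable]: "bad s \<in> borel_measurable square_measure"
  by (intro borel_imp_square_measurable borel_measurable_bad)

lemma measurable_summand [measurable]: "summand p \<in> borel_measurable square_measure"
  unfolding summand_def[abs_def] by measurable

lemma abs_summand [simp]: "\<bar>summand p z\<bar> = \<bar>coeff p\<bar>"
  by (simp add: summand_def abs_mult)

lemma abs_bad_le: "\<bar>bad s z\<bar> \<le> 2 ^ s" "0 \<le> bad s z"
  using bad_values[of s z] by auto

lemma step_in_L1: "weight \<mu> \<Longrightarrow> step s \<in> weighted_L1 \<mu>"
  using abs_step_le by (intro weighted_L1_bounded) auto

lemma summand_in_L1: "weight \<mu> \<Longrightarrow> summand p \<in> weighted_L1 \<mu>"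
  by (intro weighted_L1_bounded[of _ _ "\<bar>coeff p\<bar>"]) auto

lemma sum_summand_in_L1:
  assumes "weight \<mu>"
  shows "(\<lambda>z. \<Sum>p\<in>F. summand p z) \<in> weighted_L1 \<mu>"
proof (rule weighted_L1_bounded[OF assms])
  show "\<bar>\<Sum>p\<in>F. summand p z\<bar> \<le> (\<Sum>p\<in>F. \<bar>coeff p\<bar>)" for z
    using sum_abs[of "\<lambda>p. summand p z" F] by simp
qed measurable

lemma weighted_integral_summand_le:
  assumes "weight \<mu>"
  shows "weighted_integral \<mu> (summand p) \<le> \<bar>coeff p\<bar>"
  by (rule weighted_integral_mono_AE[OF assms summand_in_L1[OF assms]]) simp_all

text \<open>A character has modulus 1 and the weight is at most 1, so the integral is at most the
  coefficient, and coefficients in block s are at most (1/2)^s.\<close>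

lemma finite_large_summands:
  assumes "weight \<mu>" "0 < \<delta>"
  shows "finite {p \<in> spectrum. \<delta> \<le> weighted_integral \<mu> (summand p)}"
proof -
  obtain n :: nat where n: "(1/2) ^ n < \<delta>"
    using real_arch_pow_inv[of \<delta> "1/2"] assms(2) by auto
  have "{p \<in> spectrum. \<delta> \<le> weighted_integral \<mu> (summand p)} \<subseteq> (\<Union>s<n. set (block s))"
  proof
    fix p assume p: "p \<in> {p \<in> spectrum. \<delta> \<le> weighted_integral \<mu> (summand p)}"
    then obtain s u where s: "p \<in> set (block s)" "u \<in> cells (m s)" "p \<in> unit_spectrum s u"
      by (auto simp: spectrum_eq set_block)
    have "s < n"
    proof (rule ccontr)
      assume "\<not> s < n"
      then have "(1/2 :: real) ^ s \<le> (1/2) ^ n" by (intro power_decreasing) auto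
      have "s + b s + 1 \<le> (s + 2) * (s + b s + 1)" by simp
      then have "b s + s \<le> 2 * m s" using m_ge[of s] by linarith
      then have "(2::real) ^ (b s + s) \<le> 2 ^ (2 * m s)" by (intro power_increasing) auto
      then have "(2::real) ^ b s * 2 ^ s \<le> 4 ^ m s" by (simp add: power_add power_mult)
      then have "(2::real) ^ b s / 4 ^ m s \<le> (1/2) ^ s"
        by (simp add: power_divide field_simps)
      then have "weighted_integral \<mu> (summand p) \<le> (1/2) ^ s"
        using weighted_integral_summand_le[OF assms(1), of p] abs_coeff[OF s(2,3)] by linarith
      then show False using p n \<open>(1/2 :: real) ^ s \<le> (1/2) ^ n\<close> by auto
    qed
    then show "p \<in> (\<Union>s<n. set (block s))" using s by blast
  qed
  then show ?thesis by (rule finite_subset) simp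
qed

text \<open>Block 0 has no digits and hence no characters, but all later blocks are nonempty, and
  they are disjoint.\<close>

lemma infinite_spectrum: "infinite spectrum"
proof
  assume "finite spectrum"
  then have "finite {s. set (block s) \<inter> spectrum \<noteq> {}}"
    using block_disjoint by (rule finite_disjoint_meets)
  moreover have "{1..} \<subseteq> {s. set (block s) \<inter> spectrum \<noteq> {}}"
  proof
    fix s :: nat assume "s \<in> {1..}"
    then have "digits s (0, 0) \<noteq> {}" using card_digits[of s "(0, 0)"] by auto
    moreover have 0: "(0, 0) \<in> cells (m s)" by (simp add: cells_def)
    ultimately have "unit_terms (m s) (digits s (0, 0)) \<noteq> {}"
      unfolding unit_terms_def by auto
    then have "set (block s) \<noteq> {}" using 0 by (auto simp: set_block unit_spectrum_def)
    then show "s \<in> {s. set (block s) \<inter> spectrum \<noteq> {}}"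
      by (simp add: Int_absorb2 block_subset)
  qed
  ultimately show False using finite_subset infinite_Ici by blast
qed

context
  fixes \<mu> s
  assumes \<mu>: "weight \<mu>"
    and small: "AE z in square_measure. z \<in> bad_set s \<longrightarrow> \<mu> z \<le> (1/2) ^ (b s + 2 * s + 1)"
begin

text \<open>Origin of the exponent b s + 2 s + 1: the weight has to cancel 2^(b s) from the step
  function and 2^s from \<open>bad s\<close>, and leave (1/2)^(s + 1).\<close>

lemma AE_step_bad: "AE z in square_measure. \<bar>step s z\<bar> * bad s z * \<mu> z \<le> (1/2) ^ Suc s"
proof -
  have "AE z in square_measure. z \<in> unit_square" by (rule AE_I2) simp
  with small show ?thesis
  proof eventually_elim
    case (elim z)
    show ?case
    proof (cases "bad s z = 0")
      case False
      then have bad: "bad s z = 2 ^ s" "z \<in> bad_set s"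
        using bad_values[of s z] elim by (auto simp: bad_set_def)
      have 1: "\<bar>step s z\<bar> * bad s z \<le> 2 ^ b s * 2 ^ s"
        unfolding bad(1) using abs_step_le by (rule mult_right_mono) simp
      have 2: "\<mu> z \<le> (1/2) ^ (b s + 2 * s + 1)" using elim(1) bad(2) by (rule mp)
      have "0 \<le> \<mu> z" using weightD(2)[OF \<mu>] elim(2) .
      then have "\<bar>step s z\<bar> * bad s z * \<mu> z \<le> 2 ^ b s * 2 ^ s * (1/2) ^ (b s + 2 * s + 1)"
        by (intro mult_mono[OF 1 2]) simp_all
      also have "\<dots> = (1/2) ^ Suc s"
      proof -
        have "b s + 2 * s + 1 = b s + (s + Suc s)" by simp
        moreover have "2 ^ i * 2 ^ j * ((1/2) ^ i * ((1/2) ^ j * x)) = x" for i j and x :: real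
          by (simp add: power_divide)
        ultimately show ?thesis by (simp only: power_add)
      qed
      finally show ?thesis .
    qed simp
  qed
qed

lemma weighted_integral_step_bad: "weighted_integral \<mu> (\<lambda>z. step s z * bad s z) \<le> (1/2) ^ Suc s"
proof -
  have "(\<lambda>z. step s z * bad s z) \<in> weighted_L1 \<mu>"
  proof (rule weighted_L1_bounded[OF \<mu>])
    show "\<bar>step s z * bad s z\<bar> \<le> 2 ^ b s * 2 ^ s" for z
      unfolding abs_mult using abs_step_le abs_bad_le by (intro mult_mono) auto
  qed measurable
  then have "integrable square_measure (\<lambda>z. \<bar>step s z * bad s z\<bar> * \<mu> z)"
    using \<mu> by (simp add: weighted_L1_iff)
  then have "weighted_integral \<mu> (\<lambda>z. step s z * bad s z) \<le> (LINT z|square_measure. (1/2) ^ Suc s)"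
    unfolding weighted_integral_def
    using AE_step_bad abs_bad_le(2) by (intro integral_mono_AE) (auto simp: abs_mult)
  then show ?thesis by simp
qed

lemma block_approx: "weighted_integral \<mu> (\<lambda>z. step s z - (\<Sum>p\<leftarrow>block s. summand p z)) \<le> (1/2) ^ s"
proof -
  have eq: "step s z - (\<Sum>p\<leftarrow>block s. summand p z) = step s z * bad s z" for z
    by (simp add: sum_block step_def algebra_simps)
  show ?thesis
    unfolding eq by (rule order_trans[OF weighted_integral_step_bad]) simp
qed

text \<open>The completed cells are dominated by the step function plus its product with
  \<open>bad s\<close>, and the incomplete cell is estimated without the weight, which is at most 1.
  Each of the two errors is at most (1/2)^(s + 1).\<close>

lemma block_prefix_le:
  "weighted_integral \<mu> (\<lambda>z. \<Sum>p\<leftarrow>take n (block s). summand p z) \<le> weighted_integral \<mu> (step s) + (1/2) ^ s"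
proof -
  obtain U F where F: "F \<subseteq> spectrum" "finite F" and
    split: "\<And>z. (\<Sum>p\<leftarrow>take n (block s). summand p z)
      = (if cell (m s) z \<in> U then v s (cell (m s) z) * (1 - bad s z) else 0) + (\<Sum>p\<in>F. summand p z)" and
    rest: "(LINT z|square_measure. \<bar>\<Sum>p\<in>F. summand p z\<bar>) \<le> (1/2) ^ Suc s"
    by (rule block_prefix[of n s]) (erule that; simp)
  define main where "main z = (if cell (m s) z \<in> U then step s z * (1 - bad s z) else 0)" for z
  have [measurable]: "\<mu> \<in> borel_measurable square_measure" using \<mu> by (rule weightD)
  have "(\<lambda>z. if cell (m s) z \<in> U then 1 else 0 :: real) \<in> borel_measurable square_measure"
    unfolding cell_def
    by (intro borel_imp_square_measurable
        measurable_dyadic_cells[where G = "\<lambda>a c z. if (a, c) \<in> U then 1 else 0"]) simp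
  then have "(\<lambda>z. (if cell (m s) z \<in> U then 1 else 0) * (step s z * (1 - bad s z))) \<in> borel_measurable square_measure"
    by (rule borel_measurable_times[OF _ borel_measurable_times[OF measurable_step
            borel_measurable_diff[OF borel_measurable_const measurable_bad]]])
  also have "(\<lambda>z. (if cell (m s) z \<in> U then 1 else 0) * (step s z * (1 - bad s z))) = main"
    by (auto simp: main_def)
  finally have main_meas: "main \<in> borel_measurable square_measure" .
  have main_le: "\<bar>main z\<bar> \<le> \<bar>step s z\<bar> + \<bar>step s z * bad s z\<bar>" for z
  proof -
    have "\<bar>main z\<bar> \<le> \<bar>step s z - step s z * bad s z\<bar>" by (simp add: main_def algebra_simps)
    then show ?thesis by linarith
  qed
  have sb: "\<bar>step s z * bad s z\<bar> \<le> 2 ^ b s * 2 ^ s" for z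
    unfolding abs_mult using abs_step_le abs_bad_le by (intro mult_mono) auto
  have sb_L1: "(\<lambda>z. step s z * bad s z) \<in> weighted_L1 \<mu>"
    by (rule weighted_L1_bounded[OF \<mu> _ sb]) measurable
  have main_L1: "main \<in> weighted_L1 \<mu>"
    by (rule weighted_L1_bounded[OF \<mu> main_meas, of "2 ^ b s + 2 ^ b s * 2 ^ s"])
      (use main_le sb abs_step_le in \<open>meson add_mono order_trans\<close>)
  have "weighted_integral \<mu> main \<le> (LINT z|square_measure. \<bar>step s z\<bar> * \<mu> z + \<bar>step s z * bad s z\<bar> * \<mu> z)"
    unfolding weighted_integral_def
  proof (rule integral_mono)
    show "integrable square_measure (\<lambda>z. \<bar>main z\<bar> * \<mu> z)"
      "integrable square_measure (\<lambda>z. \<bar>step s z\<bar> * \<mu> z + \<bar>step s z * bad s z\<bar> * \<mu> z)"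
      using main_L1 sb_L1 step_in_L1[OF \<mu>, of s] \<mu> by (auto simp: weighted_L1_iff)
    fix z assume "z \<in> space square_measure"
    then have "\<bar>main z\<bar> * \<mu> z \<le> (\<bar>step s z\<bar> + \<bar>step s z * bad s z\<bar>) * \<mu> z"
      using main_le weightD(2)[OF \<mu>] by (intro mult_right_mono) auto
    then show "\<bar>main z\<bar> * \<mu> z \<le> \<bar>step s z\<bar> * \<mu> z + \<bar>step s z * bad s z\<bar> * \<mu> z"
      by (simp add: distrib_right)
  qed
  also have "\<dots> = weighted_integral \<mu> (step s) + weighted_integral \<mu> (\<lambda>z. step s z * bad s z)"
    unfolding weighted_integral_def using sb_L1 step_in_L1[OF \<mu>, of s] \<mu>
    by (intro Bochner_Integration.integral_add) (auto simp: weighted_L1_iff)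
  finally have 1: "weighted_integral \<mu> main \<le> weighted_integral \<mu> (step s) + (1/2) ^ Suc s"
    using weighted_integral_step_bad by linarith
  have "weighted_integral \<mu> (\<lambda>z. \<Sum>p\<in>F. summand p z) \<le> (LINT z|square_measure. \<bar>\<Sum>p\<in>F. summand p z\<bar>)"
    unfolding weighted_integral_def
  proof (rule integral_mono)
    show "integrable square_measure (\<lambda>z. \<bar>\<Sum>p\<in>F. summand p z\<bar> * \<mu> z)"
      using sum_summand_in_L1[OF \<mu>, of F] \<mu> by (simp add: weighted_L1_iff)
    show "integrable square_measure (\<lambda>z. \<bar>\<Sum>p\<in>F. summand p z\<bar>)"
      unfolding summand_def by simp
    fix z assume "z \<in> space square_measure"
    then show "\<bar>\<Sum>p\<in>F. summand p z\<bar> * \<mu> z \<le> \<bar>\<Sum>p\<in>F. summand p z\<bar>"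
      using weightD(2,3)[OF \<mu>] by (intro mult_left_le) auto
  qed
  then have 2: "weighted_integral \<mu> (\<lambda>z. \<Sum>p\<in>F. summand p z) \<le> (1/2) ^ Suc s"
    using rest by linarith
  have "weighted_integral \<mu> (\<lambda>z. \<Sum>p\<leftarrow>take n (block s). summand p z)
      = weighted_integral \<mu> (\<lambda>z. main z + (\<Sum>p\<in>F. summand p z))"
    by (simp only: split main_def step_def)
  also have "\<dots> \<le> weighted_integral \<mu> main + weighted_integral \<mu> (\<lambda>z. \<Sum>p\<in>F. summand p z)"
    by (intro weighted_L1_add \<mu> main_L1 sum_summand_in_L1)
  also have "\<dots> \<le> weighted_integral \<mu> (step s) + (1/2) ^ s"
    using 1 2 by simp
  finally show ?thesis .
qed

end

text \<open>\<open>greedy_rearrangement\<close> is applied in the additive group of functions, where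
  sums and differences are pointwise; the unfolding of these operations is the bridge between its
  terms and those of the weighted space.\<close>

lemma rearrangement:
  assumes \<mu>: "weight \<mu>"
    and small: "\<And>s. s \<ge> s0 \<Longrightarrow> AE z in square_measure. z \<in> bad_set s \<longrightarrow> \<mu> z \<le> (1/2) ^ (b s + 2 * s + 1)"
    and dense: "\<And>f \<delta> n. f \<in> weighted_L1 \<mu> \<Longrightarrow> \<delta> > 0 \<Longrightarrow> \<exists>s\<ge>n. weighted_integral \<mu> (\<lambda>z. f z - step s z) < \<delta>"
    and f: "f \<in> weighted_L1 \<mu>"
  obtains \<pi> where "bij_betw \<pi> (UNIV :: nat set) spectrum"
    "(\<lambda>n. weighted_L1_norm \<mu> (\<lambda>z. (\<Sum>j<n. summand (\<pi> j) z) - f z)) \<longlonglongrightarrow> 0"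
proof -
  have "(0 :: real \<times> real \<Rightarrow> real) \<in> weighted_L1 \<mu>"
    by (rule weighted_L1_bounded[OF \<mu>, of _ 0]) (auto simp: zero_fun_def)
  then have sum_V: "sum_list (map summand l) \<in> weighted_L1 \<mu>" for l
    using weighted_L1_add(1)[OF \<mu> summand_in_L1[OF \<mu>]] by (induction l) (simp_all add: plus_fun_def)
  obtain \<pi> where \<pi>: "bij_betw \<pi> (UNIV :: nat set) spectrum"
    "(\<lambda>n. weighted_integral \<mu> (f - (\<Sum>j<n. summand (\<pi> j)))) \<longlonglongrightarrow> 0"
  proof (rule greedy_rearrangement[where N = "weighted_integral \<mu>" and V = "weighted_L1 \<mu>" and h = summand
        and A = spectrum and L = block and \<phi> = step and start = s0 and f = f])
    show "finite {p \<in> spectrum. \<delta> \<le> weighted_integral \<mu> (summand p)}" if "\<delta> > 0" for \<delta>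
      by (rule finite_large_summands[OF \<mu> that])
    show "weighted_integral \<mu> (sum_list (map summand (take t (block s)))) \<le> weighted_integral \<mu> (step s) + (1/2) ^ s"
      if "s0 \<le> s" for s t
      using block_prefix_le[OF \<mu> small[OF that]] by (simp add: sum_list_fun_apply[abs_def])
    show "weighted_integral \<mu> (step s - sum_list (map summand (block s))) \<le> (1/2) ^ s" if "s0 \<le> s" for s
      using block_approx[OF \<mu> small[OF that]] by (simp add: fun_diff_def sum_list_fun_apply)
    show "\<exists>s\<ge>n. weighted_integral \<mu> (u - step s) < \<delta>" if "u \<in> weighted_L1 \<mu>" "\<delta> > 0" for u \<delta> n
      using dense[OF that] by (simp add: fun_diff_def)
    show "u - w \<in> weighted_L1 \<mu>" "weighted_integral \<mu> (u - w) \<le> weighted_integral \<mu> u + weighted_integral \<mu> w"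
      "weighted_integral \<mu> (u + w) \<le> weighted_integral \<mu> u + weighted_integral \<mu> w"
      if "u \<in> weighted_L1 \<mu>" "w \<in> weighted_L1 \<mu>" for u w
      using weighted_L1_diff[OF \<mu> that] weighted_L1_add[OF \<mu> that] by (simp_all add: fun_diff_def plus_fun_def)
  qed (use f sum_V step_in_L1[OF \<mu>] weighted_integral_nonneg[OF \<mu>] infinite_spectrum
      distinct_block block_subset block_disjoint in auto)
  have S: "(\<lambda>z. \<Sum>j<n. summand (\<pi> j) z) \<in> weighted_L1 \<mu>" for n
    using sum_V[of "map \<pi> [0..<n]"]
    by (simp add: sum_list_fun_apply[abs_def] interv_sum_list_conv_sum_set_nat lessThan_atLeast0 comp_def)
  have "weighted_L1_norm \<mu> (\<lambda>z. (\<Sum>j<n. summand (\<pi> j) z) - f z)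
      = ennreal (weighted_integral \<mu> (f - (\<Sum>j<n. summand (\<pi> j))))" for n
  proof -
    have "weighted_L1_norm \<mu> (\<lambda>z. (\<Sum>j<n. summand (\<pi> j) z) - f z)
      = ennreal (weighted_integral \<mu> (\<lambda>z. (\<Sum>j<n. summand (\<pi> j) z) - f z))"
      by (intro weighted_L1_norm_eq weighted_L1_diff \<mu> S f)
    then show ?thesis
      by (simp add: weighted_integral_def sum_fun_apply abs_minus_commute)
  qed
  moreover have "(\<lambda>n. ennreal (weighted_integral \<mu> (f - (\<Sum>j<n. summand (\<pi> j))))) \<longlonglongrightarrow> ennreal 0"
    using \<pi>(2) by (intro tendsto_ennrealI)
  ultimately show ?thesis using \<pi>(1) by (intro that[of \<pi>]) simp_all
qed

end

text \<open>The diagonal enumerates A by \<pi>, and the places off it are matched with the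
  complement of A, both being countably infinite; there the terms vanish. A partial sum then depends
  only on how far its index region reaches along the diagonal.\<close>

lemma diagonal_rearrangement:
  fixes g :: "nat \<times> nat \<Rightarrow> 'a \<Rightarrow> real"
  assumes \<pi>: "bij_betw \<pi> (UNIV :: nat set) A" and A: "A \<subseteq> pos_pairs" "infinite (pos_pairs - A)"
    and zero: "\<And>p z. p \<notin> A \<Longrightarrow> g p z = 0"
  obtains \<sigma> where "bij_betw \<sigma> pos_pairs pos_pairs"
    "\<And>n k z. rect_sum (g \<circ> \<sigma>) n k z = (\<Sum>j<min n k. g (\<pi> j) z)"
    "\<And>R z. spher_sum (g \<circ> \<sigma>) R z = (\<Sum>j<nat \<lfloor>sqrt (R\<^sup>2 / 2)\<rfloor>. g (\<pi> j) z)"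
proof -
  define D where "D = range (\<lambda>j. (Suc j, Suc j))"
  have D: "D \<subseteq> pos_pairs" by (auto simp: D_def)
  have "range (\<lambda>i. (1, i + 2)) \<subseteq> pos_pairs - D" by (auto simp: D_def)
  moreover have "infinite (range (\<lambda>i. (1 :: nat, i + 2 :: nat)))"
    by (rule range_inj_infinite) (auto simp: inj_on_def)
  ultimately have "infinite (pos_pairs - D)" using finite_subset by blast
  then obtain e where e: "bij_betw e (UNIV :: nat set) (pos_pairs - D)"
    using bij_betw_from_nat_into[OF countableI_type] by blast
  obtain e' where e': "bij_betw e' (UNIV :: nat set) (pos_pairs - A)"
    using bij_betw_from_nat_into[OF countableI_type A(2)] by blast
  define \<rho> where "\<rho> = e' \<circ> inv_into UNIV e"
  have \<rho>: "bij_betw \<rho> (pos_pairs - D) (pos_pairs - A)"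
    unfolding \<rho>_def by (rule bij_betw_trans[OF bij_betw_inv_into[OF e] e'])
  define \<sigma> where "\<sigma> p = (if p \<in> D then \<pi> (fst p - 1) else \<rho> p)" for p
  have "bij_betw (\<lambda>p. \<pi> (fst p - 1)) D A"
  proof -
    have "bij_betw (\<lambda>p. fst p - 1) D (UNIV :: nat set)"
      by (rule bij_betw_byWitness[where f' = "\<lambda>j. (Suc j, Suc j)"]) (auto simp: D_def)
    from bij_betw_trans[OF this \<pi>] show ?thesis by (simp add: comp_def)
  qed
  then have \<sigma>D: "bij_betw \<sigma> D A"
    by (rule iffD1[OF bij_betw_cong, rotated]) (simp add: \<sigma>_def)
  have \<sigma>D': "bij_betw \<sigma> (pos_pairs - D) (pos_pairs - A)"
    using \<rho> by (rule iffD1[OF bij_betw_cong, rotated]) (simp add: \<sigma>_def)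
  have "bij_betw \<sigma> (D \<union> (pos_pairs - D)) (A \<union> (pos_pairs - A))"
    using \<sigma>D \<sigma>D' by (rule bij_betw_combine) blast
  moreover have "D \<union> (pos_pairs - D) = pos_pairs" "A \<union> (pos_pairs - A) = pos_pairs"
    using D A(1) by blast+
  ultimately have \<sigma>: "bij_betw \<sigma> pos_pairs pos_pairs" by simp
  have diag: "(\<Sum>p\<in>X. (g \<circ> \<sigma>) p z) = (\<Sum>j<n. g (\<pi> j) z)"
    if X: "finite X" "X \<subseteq> pos_pairs" "\<And>j. (Suc j, Suc j) \<in> X \<longleftrightarrow> j < n" for X n z
  proof -
    have "(g \<circ> \<sigma>) p z = 0" if "p \<in> X - D" for p
    proof -
      have "\<sigma> p \<in> \<sigma> ` (pos_pairs - D)" using that X(2) by blast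
      then have "\<sigma> p \<notin> A" unfolding bij_betw_imp_surj_on[OF \<sigma>D'] by blast
      then show ?thesis by (simp add: zero)
    qed
    then have "(\<Sum>p\<in>X. (g \<circ> \<sigma>) p z) = (\<Sum>p\<in>X \<inter> D. (g \<circ> \<sigma>) p z)"
      using X(1) by (intro sum.mono_neutral_right) auto
    also have "X \<inter> D = (\<lambda>j. (Suc j, Suc j)) ` {..<n}"
      using X(3) by (auto simp: D_def)
    also have "(\<Sum>p\<in>(\<lambda>j. (Suc j, Suc j)) ` {..<n}. (g \<circ> \<sigma>) p z) = (\<Sum>j<n. g (\<pi> j) z)"
      by (subst sum.reindex) (auto simp: inj_on_def \<sigma>_def D_def)
    finally show ?thesis .
  qed
  show ?thesis
  proof (rule that[OF \<sigma>])
    fix n k z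
    have "rect_sum (g \<circ> \<sigma>) n k z = (\<Sum>p\<in>{1..n} \<times> {1..k}. (g \<circ> \<sigma>) p z)"
      unfolding rect_sum_def by (simp add: sum.cartesian_product)
    also have "\<dots> = (\<Sum>j<min n k. g (\<pi> j) z)" by (rule diag) auto
    finally show "rect_sum (g \<circ> \<sigma>) n k z = (\<Sum>j<min n k. g (\<pi> j) z)" .
  next
    fix R z
    define X where "X = {(k, \<nu>) \<in> pos_pairs. (real k)\<^sup>2 + (real \<nu>)\<^sup>2 \<le> R\<^sup>2}"
    have "X \<subseteq> {..nat \<lfloor>R\<^sup>2\<rfloor>} \<times> {..nat \<lfloor>R\<^sup>2\<rfloor>}"
    proof clarify
      fix k l assume "(k, l) \<in> X"
      then have "1 \<le> real k" "1 \<le> real l" "(real k)\<^sup>2 + (real l)\<^sup>2 \<le> R\<^sup>2" by (auto simp: X_def)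
      moreover have "real k \<le> (real k)\<^sup>2" "real l \<le> (real l)\<^sup>2"
        using calculation by (simp_all add: power2_eq_square)
      moreover have "0 \<le> (real k)\<^sup>2" "0 \<le> (real l)\<^sup>2" by simp_all
      ultimately have "real k \<le> R\<^sup>2" "real l \<le> R\<^sup>2" by linarith+
      then show "k \<in> {..nat \<lfloor>R\<^sup>2\<rfloor>} \<and> l \<in> {..nat \<lfloor>R\<^sup>2\<rfloor>}" by (simp add: le_nat_floor)
    qed
    then have fin: "finite X" by (rule finite_subset) simp
    \<comment> \<open>The diagonal point lies in the disc iff 2 (j + 1)^2 \<le> R^2. Position
      \<open>Suc j\<close> holds the term \<open>\<pi> j\<close>, so the count of terms is the
      integer part of the root.\<close>
    have "(Suc j, Suc j) \<in> X \<longleftrightarrow> j < nat \<lfloor>sqrt (R\<^sup>2 / 2)\<rfloor>" for j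
    proof -
      have "(Suc j, Suc j) \<in> X \<longleftrightarrow> (real (Suc j))\<^sup>2 \<le> R\<^sup>2 / 2" by (auto simp: X_def)
      also have "\<dots> \<longleftrightarrow> real (Suc j) \<le> sqrt (R\<^sup>2 / 2)"
        by (metis of_nat_0_le_iff real_le_rsqrt real_sqrt_le_iff real_sqrt_unique)
      also have "\<dots> \<longleftrightarrow> Suc j \<le> nat \<lfloor>sqrt (R\<^sup>2 / 2)\<rfloor>"
        using le_nat_floor[of "Suc j" "sqrt (R\<^sup>2 / 2)"] by linarith
      finally show ?thesis by (simp add: Suc_le_eq)
    qed
    then have "(\<Sum>p\<in>X. (g \<circ> \<sigma>) p z) = (\<Sum>j<nat \<lfloor>sqrt (R\<^sup>2 / 2)\<rfloor>. g (\<pi> j) z)"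
      using fin by (intro diag) (auto simp: X_def)
    then show "spher_sum (g \<circ> \<sigma>) R z = (\<Sum>j<nat \<lfloor>sqrt (R\<^sup>2 / 2)\<rfloor>. g (\<pi> j) z)"
      by (simp add: spher_sum_def X_def case_prod_unfold)
  qed
qed

section \<open>The number of diagonal terms tends to infinity\<close>

lemma filterlim_min: "filterlim (\<lambda>(n, k). min n k) sequentially (sequentially \<times>\<^sub>F sequentially)"
  unfolding filterlim_at_top eventually_prod_sequentially by auto

lemma filterlim_spherical: "filterlim (\<lambda>R::real. nat \<lfloor>sqrt (R\<^sup>2 / 2)\<rfloor>) sequentially at_top"
  unfolding filterlim_at_top eventually_at_top_linorder
proof
  fix n :: nat
  have "n \<le> nat \<lfloor>sqrt (R\<^sup>2 / 2)\<rfloor>" if "R \<ge> 2 * real n" for R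
  proof -
    have "(2 * real n)\<^sup>2 \<le> R\<^sup>2" using that by (intro power_mono) auto
    then have "4 * (real n)\<^sup>2 \<le> R\<^sup>2" by (simp add: power_mult_distrib)
    then have "(real n)\<^sup>2 \<le> R\<^sup>2 / 2" using zero_le_power2[of "real n"] by linarith
    then have "real n \<le> sqrt (R\<^sup>2 / 2)" by (rule real_le_rsqrt)
    then show ?thesis by (rule le_nat_floor)
  qed
  then show "\<exists>N. \<forall>R\<ge>N. n \<le> nat \<lfloor>sqrt (R\<^sup>2 / 2)\<rfloor>" by blast
qed

text \<open>Agreement of indices means that the product in \<open>prod_rademacher_eq\<close> is
  nonzero, and then so is the product of fewer of its factors.\<close>

lemma dyadic_index_mono_level:
  assumes "dyadic_index k x = dyadic_index k y" "d \<le> k"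
  shows "dyadic_index d x = dyadic_index d y"
proof -
  have "(\<Prod>i<k. 1 + rademacher i x * rademacher i y) \<noteq> 0"
    using assms(1) by (simp add: prod_rademacher_eq)
  then have "(\<Prod>i<d. 1 + rademacher i x * rademacher i y) \<noteq> 0"
    using assms(2) by (auto simp: prod_zero_iff)
  then show ?thesis by (simp add: prod_rademacher_eq split: if_splits)
qed

lemma dyadic_step_corner:
  assumes "d \<le> k"
  shows "dyadic_step d vs (real (fst (cell k z)) / 2 ^ k, real (snd (cell k z)) / 2 ^ k) = dyadic_step d vs z"
proof -
  have "dyadic_index d (real (dyadic_index k x) / 2 ^ k) = dyadic_index d x" for x
    by (rule dyadic_index_mono_level[OF dyadic_index_corner[OF dyadic_index_less] assms])
  then show ?thesis by (simp add: dyadic_step_def cell_def)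
qed

text \<open>Every pair of a level and a value list is the datum of infinitely many blocks.\<close>

definition step_data :: "nat \<Rightarrow> nat \<times> rat list" where
  "step_data s = from_nat (fst (prod_decode s))"

text \<open>As n \<le> 2^n, an integer bound for the values can itself serve as the exponent
  required by \<open>v_le\<close>.\<close>

definition step_bound :: "nat \<Rightarrow> nat" where
  "step_bound s = nat \<lceil>\<Sum>q\<leftarrow>snd (step_data s). \<bar>of_rat q :: real\<bar>\<rceil>"

text \<open>The added summand makes the cells at least as fine as those of the step function, which
  is therefore constant on each of them.\<close>

definition block_level :: "nat \<Rightarrow> nat" where
  "block_level s = (s + 2) * (s + step_bound s + 1) + fst (step_data s)"

definition block_value :: "nat \<Rightarrow> nat \<times> nat \<Rightarrow> real" where
  "block_value s u = dyadic_step (fst (step_data s)) (snd (step_data s))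
     (real (fst u) / 2 ^ block_level s, real (snd u) / 2 ^ block_level s)"

interpretation walsh_blocks block_level step_bound block_value
proof
  fix s u
  have "\<bar>block_value s u\<bar> \<le> (\<Sum>q\<leftarrow>snd (step_data s). \<bar>of_rat q\<bar>)"
    unfolding block_value_def by (rule abs_dyadic_step_le)
  also have "\<dots> \<le> real (step_bound s)"
    unfolding step_bound_def by (rule real_nat_ceiling_ge)
  also have "\<dots> \<le> 2 ^ step_bound s"
    by (rule less_imp_le[OF of_nat_less_two_power])
  finally show "\<bar>block_value s u\<bar> \<le> 2 ^ step_bound s" .
qed (simp add: block_level_def)

lemma step_eq: "step s = dyadic_step (fst (step_data s)) (snd (step_data s))"
proof
  fix z
  have "fst (step_data s) \<le> block_level s" by (simp add: block_level_def)
  then show "step s z = dyadic_step (fst (step_data s)) (snd (step_data s)) z"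
    unfolding step_def block_value_def by (rule dyadic_step_corner)
qed

lemma step_dense:
  assumes "weight \<mu>" "f \<in> weighted_L1 \<mu>" "\<delta> > 0"
  shows "\<exists>s\<ge>n. weighted_integral \<mu> (\<lambda>z. f z - step s z) < \<delta>"
proof -
  obtain d vs where "weighted_integral \<mu> (\<lambda>z. f z - dyadic_step d vs z) < \<delta>"
    by (rule dyadic_step_dense[OF assms])
  \<comment> \<open>The first component of the code selects the step function; the second is free,
    and taking it to be n makes the code at least n.\<close>
  then have "weighted_integral \<mu> (\<lambda>z. f z - step (prod_encode (to_nat (d, vs), n)) z) < \<delta>"
    by (simp add: step_eq step_data_def)
  then show ?thesis using le_prod_encode_2 by blast
qed

theorem theorem4:
  shows "\<exists>c :: nat \<Rightarrow> nat \<Rightarrow> real.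
    (\<forall>q :: real. q > 2 \<longrightarrow> (\<lambda>(n, k). \<bar>c n k\<bar> powr q) summable_on pos_pairs) \<and>
    (\<forall>\<epsilon> :: real. \<epsilon> > 0 \<longrightarrow>
      (\<exists>\<mu> :: real \<times> real \<Rightarrow> real.
         \<mu> \<in> borel_measurable (lebesgue_on unit_square) \<and>
         (\<forall>p \<in> unit_square. 0 < \<mu> p \<and> \<mu> p \<le> 1) \<and>
         measure lebesgue {p \<in> unit_square. \<mu> p \<noteq> 1} < \<epsilon> \<and>
         universal_rearrangements \<mu>
           (\<lambda>(n, k) (x, y). c n k * walsh n x * walsh k y)))"
proof (intro exI[of _ "\<lambda>n k. coeff (n, k)"] conjI allI impI)
  show "(\<lambda>(n, k). \<bar>coeff (n, k)\<bar> powr q) summable_on pos_pairs" if "q > 2" for q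
    using summable_coeff[OF that] by (simp add: case_prod_unfold)
next
  fix \<epsilon> :: real assume "\<epsilon> > 0"
  obtain \<mu> s0 where \<mu>: "weight \<mu>" "measure lebesgue {z \<in> unit_square. \<mu> z \<noteq> 1} < \<epsilon>"
    and small: "\<And>s. s \<ge> s0 \<Longrightarrow> AE z in square_measure. z \<in> bad_set s \<longrightarrow> \<mu> z \<le> (1/2) ^ (step_bound s + 2 * s + 1)"
  proof (rule weight_exists[of bad_set "\<lambda>s. (1/2) ^ (step_bound s + 2 * s + 1)" \<epsilon>])
    show "bad_set s \<in> sets square_measure" for s by (rule bad_set_sets)
    show "measure square_measure (bad_set s) \<le> (1/2) ^ s" for s by (simp add: measure_bad_set)
    show "(1/2 :: real) ^ (step_bound s + 2 * s + 1) \<le> 1" for s by (rule power_le_one) auto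
  qed (use \<open>\<epsilon> > 0\<close> in auto)
  have g: "(\<lambda>(n, k) (x, y). coeff (n, k) * walsh n x * walsh k y) = summand"
    by (auto simp: summand_def walsh2_def fun_eq_iff)
  have "universal_rearrangements \<mu> summand"
    unfolding universal_rearrangements_def
  proof
    fix f assume "f \<in> weighted_L1 \<mu>"
    then obtain \<pi> where \<pi>: "bij_betw \<pi> (UNIV :: nat set) spectrum"
      "(\<lambda>n. weighted_L1_norm \<mu> (\<lambda>z. (\<Sum>j<n. summand (\<pi> j) z) - f z)) \<longlonglongrightarrow> 0"
      using rearrangement[OF \<mu>(1) small step_dense[OF \<mu>(1)]] by blast
    obtain \<sigma> where \<sigma>: "bij_betw \<sigma> pos_pairs pos_pairs"
      "\<And>n k z. rect_sum (summand \<circ> \<sigma>) n k z = (\<Sum>j<min n k. summand (\<pi> j) z)"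
      "\<And>R z. spher_sum (summand \<circ> \<sigma>) R z = (\<Sum>j<nat \<lfloor>sqrt (R\<^sup>2 / 2)\<rfloor>. summand (\<pi> j) z)"
      using diagonal_rearrangement[OF \<pi>(1) spectrum_pos infinite_spectrum_complement, of summand]
      by (auto simp: summand_def coeff_def)
    have "((\<lambda>(n, k). weighted_L1_norm \<mu> (\<lambda>p. rect_sum (summand \<circ> \<sigma>) n k p - f p)) \<longlongrightarrow> 0)
        (sequentially \<times>\<^sub>F sequentially)"
      using filterlim_compose[OF \<pi>(2) filterlim_min] by (simp add: \<sigma>(2) case_prod_unfold)
    moreover have "((\<lambda>R. weighted_L1_norm \<mu> (\<lambda>p. spher_sum (summand \<circ> \<sigma>) R p - f p)) \<longlongrightarrow> 0) at_top"
      using filterlim_compose[OF \<pi>(2) filterlim_spherical] by (simp add: \<sigma>(3))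
    ultimately show "\<exists>\<sigma>. bij_betw \<sigma> pos_pairs pos_pairs \<and>
        ((\<lambda>(n, k). weighted_L1_norm \<mu> (\<lambda>p. rect_sum (summand \<circ> \<sigma>) n k p - f p)) \<longlongrightarrow> 0)
          (sequentially \<times>\<^sub>F sequentially) \<and>
        ((\<lambda>R. weighted_L1_norm \<mu> (\<lambda>p. spher_sum (summand \<circ> \<sigma>) R p - f p)) \<longlongrightarrow> 0) at_top"
      using \<sigma>(1) by blast
  qed
  then show "\<exists>\<mu> :: real \<times> real \<Rightarrow> real.
         \<mu> \<in> borel_measurable (lebesgue_on unit_square) \<and>
         (\<forall>p \<in> unit_square. 0 < \<mu> p \<and> \<mu> p \<le> 1) \<and>
         measure lebesgue {p \<in> unit_square. \<mu> p \<noteq> 1} < \<epsilon> \<and>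
         universal_rearrangements \<mu>
           (\<lambda>(n, k) (x, y). coeff (n, k) * walsh n x * walsh k y)"
    using \<mu> unfolding g weight_def by blast
qed

end
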